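(* Let $d\in\mathbb{N}$, $2<p\le\infty$, $1\le q\le\infty$ and $s>d/2$ (so that $s>d/p$). Let $\mathcal{U}$ be the closed unit ball of $\mathbb{B}_{pq}^s(\mathbb{R}^d)$, i.e. the set of bounded continuous functions $f:\mathbb{R}^d\to\mathbb{R}$ with $\|f\|_{s,p,q,\lambda}\le 1$. Let $\delta$ satisfy $0<\delta\le d/2-d/p$. Let $\varphi:\mathbb{R}^d\to\mathbb{R}$ be a Borel function such that $\varphi(x)\ge c$ for all $x\in\mathbb{R}^d$ and some constant $c>0$, and such that $\int_{\mathbb{R}^d}\varphi(x)\langle x\rangle^{-d-2\delta}\,d\lambda(x)=1$. Define the probability measure $\mathbb{P}$ by $d\mathbb{P}(x)=\varphi(x)\langle x\rangle^{-d-2\delta}d\lambda(x)$. Then $\mathcal{U}$ is not $\mathbb{P}$-pregaussian.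
   Context: $\lambda$ is Lebesgue measure on $\mathbb{R}^d$, $\|h\|_{r,\mu}=(\int|h|^r d\mu)^{1/r}$ (essential supremum if $r=\infty$), and $\langle x\rangle^\gamma=(1+\|x\|^2)^{\gamma/2}$ with $\|\cdot\|$ the Euclidean norm. Besov norm: fix a $C^\infty$ function $\varphi_0$ on $\mathbb{R}^d$ with $\varphi_0(x)=1$ for $\|x\|\le1$ and $\varphi_0(x)=0$ for $\|x\|\ge3/2$; put $\varphi_1(x)=\varphi_0(x/2)-\varphi_0(x)$ and $\varphi_k(x)=\varphi_1(2^{-k+1}x)$ for $k\ge1$. For a tempered distribution $T$ with Fourier transform $FT$, $\|T\|_{s,p,q,\lambda}=\big(\sum_{k\ge0}2^{ksq}\|F^{-1}(\varphi_k FT)\|_{p,\lambda}^q\big)^{1/q}$ (with $\sup_k 2^{ks}\|F^{-1}(\varphi_kFT)\|_{p,\lambda}$ if $q=\infty$). $B^s_{pq}(\mathbb{R}^d)$ is the space of real tempered distributions with finite norm; for $s>d/p$ every element has a unique bounded continuous representative, and $\mathbb{B}^s_{pq}(\mathbb{R}^d)$ denotes the space of these continuous representatives with the same norm. Pregaussian: for a probability measure $\mathbb{P}$ on $\mathbb{R}^d$ and $\mathcal{F}\subseteq\mathcal{L}^2(\mathbb{P})$, a Brownian bridge on $\mathcal{F}$ is a centered Gaussian process $\mathbb{G}$ indexed by $\mathcal{F}$ with covariance $E\mathbb{G}(f)\mathbb{G}(g)=\mathbb{P}[(f-\mathbb{P}f)(g-\mathbb{P}g)]$, inducing the semimetric $\rho(f,g)=(E[\mathbb{G}(f)-\mathbb{G}(g)]^2)^{1/2}$.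 $\mathcal{F}$ is $\mathbb{P}$-pregaussian if such a $\mathbb{G}$ can be defined so that every sample path $f\mapsto\mathbb{G}(f)$ is bounded and uniformly $\rho$-continuous on $\mathcal{F}$. *)

theory Defs
  imports "HOL-Analysis.Analysis" "HOL-Probability.Probability"
begin

coinductive smooth_fun :: "('a::euclidean_space \<Rightarrow> real) \<Rightarrow> bool" where
  "continuous_on UNIV f \<Longrightarrow> (\<forall>x. f differentiable (at x)) \<Longrightarrow>
   (\<forall>i\<in>Basis. smooth_fun (\<lambda>x. frechet_derivative f (at x) i)) \<Longrightarrow> smooth_fun f"

definition enn_powr :: "ennreal \<Rightarrow> real \<Rightarrow> ennreal" where
  "enn_powr x r = (if x = \<top> then \<top> else ennreal (enn2real x powr r))"

definition Lp_norm :: "ereal \<Rightarrow> (real^'d \<Rightarrow> complex) \<Rightarrow> ennreal" where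
  "Lp_norm p h =
    (if p = \<infinity> then esssup (lborel :: (real^'d) measure) (\<lambda>x. ennreal (norm (h x)))
     else enn_powr (\<integral>\<^sup>+ x. ennreal (norm (h x) powr real_of_ereal p) \<partial>(lborel :: (real^'d) measure))
                   (1 / real_of_ereal p))"

definition lp_phi :: "(real^'d \<Rightarrow> real) \<Rightarrow> nat \<Rightarrow> real^'d \<Rightarrow> real" where
  "lp_phi \<phi>0 k x =
    (if k = 0 then \<phi>0 x
     else (let \<phi>1 = (\<lambda>y. \<phi>0 ((1/2) *\<^sub>R y) - \<phi>0 y) in \<phi>1 ((2 powr (1 - real k)) *\<^sub>R x)))"

text \<open>Fourier conventions: \<open>F f(\<xi>) = \<integral> e^{-i x\<cdot>\<xi>} f(x) dx\<close>,
  \<open>F\<^sup>-\<^sup>1 g(x) = (2\<pi>)^{-d} \<integral> e^{i x\<cdot>\<xi>} g(\<xi>) d\<xi>\<close>.\<close>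
definition inv_fourier :: "(real^'d \<Rightarrow> complex) \<Rightarrow> real^'d \<Rightarrow> complex" where
  "inv_fourier g x = complex_of_real ((2 * pi) powr (- real CARD('d))) *
     (\<integral> \<xi>. cis (x \<bullet> \<xi>) * g \<xi> \<partial>lborel)"

text \<open>For a bounded continuous (hence tempered) function f, the Littlewood--Paley block
  \<open>F\<^sup>-\<^sup>1(\<phi>\<^sub>k F f)\<close> is the convolution of f with the Schwartz function \<open>F\<^sup>-\<^sup>1 \<phi>\<^sub>k\<close>.\<close>
definition lp_block :: "(real^'d \<Rightarrow> real) \<Rightarrow> nat \<Rightarrow> (real^'d \<Rightarrow> real) \<Rightarrow> real^'d \<Rightarrow> complex" where
  "lp_block \<phi>0 k f x =
     (\<integral> y. complex_of_real (f (x - y)) *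
            inv_fourier (\<lambda>\<xi>. complex_of_real (lp_phi \<phi>0 k \<xi>)) y \<partial>lborel)"

definition besov_norm :: "(real^'d \<Rightarrow> real) \<Rightarrow> real \<Rightarrow> ereal \<Rightarrow> ereal \<Rightarrow> (real^'d \<Rightarrow> real) \<Rightarrow> ennreal" where
  "besov_norm \<phi>0 s p q f =
    (if q = \<infinity> then (SUP k. ennreal (2 powr (real k * s)) * Lp_norm p (lp_block \<phi>0 k f))
     else enn_powr
       (\<Sum>k. ennreal (2 powr (real k * s * real_of_ereal q)) *
              enn_powr (Lp_norm p (lp_block \<phi>0 k f)) (real_of_ereal q))
       (1 / real_of_ereal q))"

definition besov_unit_ball :: "(real^'d \<Rightarrow> real) \<Rightarrow> real \<Rightarrow> ereal \<Rightarrow> ereal \<Rightarrow> (real^'d \<Rightarrow> real) set" where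
  "besov_unit_ball \<phi>0 s p q =
    {f. continuous_on UNIV f \<and> bounded (range f) \<and> besov_norm \<phi>0 s p q f \<le> 1}"

definition centered_normal :: "real \<Rightarrow> real measure" where
  "centered_normal v =
    (if v = 0 then return borel 0 else density lborel (normal_density 0 (sqrt v)))"

text \<open>A Brownian bridge on \<open>\<F>\<close> for P, defined on the probability space M:
  a centered Gaussian process with covariance \<open>P[(f - Pf)(g - Pg)]\<close>, i.e. every finite
  linear combination \<open>\<Sum> a_f G(f)\<close> is centered normal with variance
  \<open>P[(\<Sum> a_f (f - Pf))^2]\<close>.\<close>
definition brownian_bridge ::
  "'a measure \<Rightarrow> ('a \<Rightarrow> real) set \<Rightarrow> 'w measure \<Rightarrow> (('a \<Rightarrow> real) \<Rightarrow> 'w \<Rightarrow> real) \<Rightarrow> bool" where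
  "brownian_bridge P \<F> M G \<longleftrightarrow>
     prob_space M \<and>
     (\<forall>f\<in>\<F>. G f \<in> borel_measurable M) \<and>
     (\<forall>S a. finite S \<longrightarrow> S \<subseteq> \<F> \<longrightarrow>
        distr M borel (\<lambda>\<omega>. \<Sum>f\<in>S. a f * G f \<omega>) =
        centered_normal (\<integral> x. (\<Sum>f\<in>S. a f * (f x - (\<integral> y. f y \<partial>P)))\<^sup>2 \<partial>P))"

definition bb_rho :: "'w measure \<Rightarrow> (('a \<Rightarrow> real) \<Rightarrow> 'w \<Rightarrow> real) \<Rightarrow> ('a \<Rightarrow> real) \<Rightarrow> ('a \<Rightarrow> real) \<Rightarrow> real" where
  "bb_rho M G f g = sqrt (\<integral> \<omega>. (G f \<omega> - G g \<omega>)\<^sup>2 \<partial>M)"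

text \<open>\<open>\<F> \<subseteq> L^2(P)\<close> is P-pregaussian if a Brownian bridge can be defined on some probability
  space (here: on a probability space carried by the type 'w) all of whose sample paths are
  bounded and uniformly \<open>\<rho>\<close>-continuous on \<open>\<F>\<close>.\<close>
definition pregaussian :: "'w itself \<Rightarrow> 'a measure \<Rightarrow> ('a \<Rightarrow> real) set \<Rightarrow> bool" where
  "pregaussian (_ :: 'w itself) P \<F> \<longleftrightarrow>
     (\<forall>f\<in>\<F>. f \<in> borel_measurable P \<and> integrable P (\<lambda>x. (f x)\<^sup>2)) \<and>
     (\<exists>(M :: 'w measure) G. brownian_bridge P \<F> M G \<and>
        (\<forall>\<omega>\<in>space M.
           bounded ((\<lambda>f. G f \<omega>) ` \<F>) \<and>
           (\<forall>\<epsilon>>0. \<exists>\<eta>>0. \<forall>f\<in>\<F>. \<forall>g\<in>\<F>.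
              bb_rho M G f g < \<eta> \<longrightarrow> \<bar>G f \<omega> - G g \<omega>\<bar> < \<epsilon>)))"

definition jbracket :: "'a::real_normed_vector \<Rightarrow> real \<Rightarrow> real" where
  "jbracket x \<gamma> = (1 + (norm x)\<^sup>2) powr (\<gamma> / 2)"

end

theory Submission
  imports Defs
begin

text \<open>
  Take for \<open>\<psi>\<close> a tensor product of dilated Fejer kernels. Its Fourier transform is a product of tents
  supported in the unit ball, so of all Littlewood--Paley blocks of a combination
  \<open>f = \<Sum> b\<^sub>n \<psi>(\<cdot> - n)\<close> over lattice points only the one with index 0 survives, and the Besov norm of
  \<open>f\<close> is a multiple of its \<open>L\<^sup>p\<close> norm, whatever \<open>s\<close> and \<open>q\<close> are. By convexity the latter is at most a
  constant times the \<open>\<ell>\<^sup>p\<close> norm of \<open>b\<close>. On the other hand, the variance of \<open>\<psi>(\<cdot> - n)\<close> under the given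
  measure is at least of order \<open>\<langle>n\<rangle>\<^sup>-\<^sup>d\<^sup>-\<^sup>2\<^sup>\<delta>\<close>. Put \<open>b\<^sub>n = \<plusminus> K\<^sup>-\<^sup>1\<^sup>/\<^sup>p 2\<^sup>-\<^sup>k\<^sup>d\<^sup>/\<^sup>p\<close> on the dyadic boxes
  \<open>[2\<^sup>k, 2\<^sup>k\<^sup>+\<^sup>1)\<^sup>d\<close>, \<open>k < K\<close>. The \<open>\<ell>\<^sup>p\<close> norm is 1, while the supremum over the signs of the bridge at \<open>f\<close> is
  \<open>\<Sum> \<bar>b\<^sub>n\<bar> \<bar>G(\<psi>(\<cdot> - n))\<bar>\<close>, which with probability bounded below exceeds a fixed fraction of
  \<open>\<Sum> \<bar>b\<^sub>n\<bar> sd(\<psi>(\<cdot> - n))\<close>. As \<open>\<delta> \<le> d/2 - d/p\<close>, this sum is at least of order \<open>K\<^sup>1\<^sup>-\<^sup>1\<^sup>/\<^sup>p\<close>, so the sample paths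
  are unbounded.
\<close>

section \<open>The Fejer kernel on the line\<close>

text \<open>Up to a factor this is the Fejer kernel of the real line; the value 1/2 at 0 is the
  limit there, so the function is continuous.\<close>

definition fejer :: "real \<Rightarrow> real" where
  "fejer t = (if t = 0 then 1/2 else (1 - cos t) / t\<^sup>2)"

definition tent :: "real \<Rightarrow> real" where
  "tent t = max 0 (1 - \<bar>t\<bar>)"

text \<open>The half-angle formula. As a square of \<open>sinc\<close> the kernel is visibly
  nonnegative and continuous, also at 0.\<close>

lemma fejer_eq_sinc: "fejer t = (sinc (t/2))\<^sup>2 / 2"
proof -
  have "1 - cos t = 2 * (sin (t/2))\<^sup>2"
    using cos_double_sin[of "t/2"] by simp
  then show ?thesis
    by (simp add: fejer_def power2_eq_square field_simps)
qed

lemma fejer_nonneg: "0 \<le> fejer t"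
  by (simp add: fejer_eq_sinc)

lemma continuous_on_fejer [continuous_intros]:
  "continuous_on S f \<Longrightarrow> continuous_on S (\<lambda>x. fejer (f x))"
  unfolding fejer_eq_sinc by (intro continuous_intros) auto

lemma borel_measurable_fejer [measurable]: "fejer \<in> borel_measurable borel"
  by (intro borel_measurable_continuous_onI continuous_intros)

text \<open>The majorant is integrable and has a multiple of \<open>arctan\<close> as
  antiderivative; the first gives integrability of the kernel, the second lets lattice sums
  telescope.\<close>

lemma fejer_le: "fejer t \<le> 4 / (1 + t\<^sup>2)"
proof (cases "\<bar>t\<bar> \<le> 1")
  case True
  have "\<bar>sinc (t/2)\<bar> \<le> 1"
    using abs_sin_le_one abs_sin_x_le_abs_x[of "t/2"] by (auto simp: divide_le_eq)
  then have "fejer t \<le> 1/2"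
    unfolding fejer_eq_sinc by (simp add: abs_square_le_1)
  also have "1 + t\<^sup>2 \<le> 2"
    using True by (simp add: abs_square_le_1)
  then have "1/2 \<le> 4 / (1 + t\<^sup>2)"
    by (subst le_divide_eq) (auto simp: add_pos_nonneg add_nonneg_eq_0_iff)
  finally show ?thesis .
next
  case False
  then have t: "t \<noteq> 0" "1 \<le> t\<^sup>2"
    using abs_le_square_iff[of 1 t] by auto
  have "fejer t \<le> 2 / t\<^sup>2"
    using t cos_ge_minus_one[of t] by (auto simp: fejer_def intro!: divide_right_mono)
  also have "\<dots> \<le> 4 / (1 + t\<^sup>2)"
    using t by (auto simp: divide_simps add_nonneg_eq_0_iff)
  finally show ?thesis .
qed

lemma integrable_inverse_square: "integrable lborel (\<lambda>t::real. 4 / (1 + t\<^sup>2))"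
proof -
  have "integrable lborel (\<lambda>t::real. inverse (1 + t\<^sup>2))"
    using integrable_inverse_1_plus_square by (simp add: set_integrable_def)
  then have "integrable lborel (\<lambda>t::real. 4 * inverse (1 + t\<^sup>2))"
    by (rule integrable_mult_right)
  then show ?thesis
    by (simp add: field_simps)
qed

lemma integrable_fejer: "integrable lborel fejer"
  by (rule Bochner_Integration.integrable_bound[OF integrable_inverse_square])
     (auto intro!: AE_I2 simp: fejer_nonneg fejer_le abs_of_nonneg add_nonneg_nonneg)

text \<open>Its value is pi. It is carried along as a symbol and finally absorbed into the scaling
  factor \<open>\<kappa>\<close>.\<close>

definition fejer_mass :: real where
  "fejer_mass = (\<integral>t. fejer t \<partial>lborel)"

lemma fejer_mass_nonneg: "0 \<le> fejer_mass"
  unfolding fejer_mass_def by (intro integral_nonneg_AE) (simp add: fejer_nonneg)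

lemma
  shows integrable_one_minus_cos: "integrable lborel (\<lambda>t. (1 - cos (a * t)) / t\<^sup>2)"
    and integral_one_minus_cos: "(\<integral>t. (1 - cos (a * t)) / t\<^sup>2 \<partial>lborel) = \<bar>a\<bar> * fejer_mass"
proof -
  \<comment> \<open>At t = 0 the left side is \<open>a\<^sup>2 / 2\<close>, while the right side is
    0 by the convention for division by 0, so the identity can only hold almost everywhere.\<close>
  have ae: "AE t in lborel. a\<^sup>2 * fejer (a * t) = (1 - cos (a * t)) / t\<^sup>2"
    using AE_lborel_singleton[of "0::real"]
    by eventually_elim (auto simp: fejer_def power_mult_distrib)
  have int: "integrable lborel (\<lambda>t. a\<^sup>2 * fejer (a * t))"
    using lborel_integrable_real_affine[OF integrable_fejer, of a 0] by (cases "a = 0") auto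
  show "integrable lborel (\<lambda>t. (1 - cos (a * t)) / t\<^sup>2)"
    by (rule iffD1[OF integrable_cong_AE, OF _ _ ae int]) auto
  have "(\<integral>t. (1 - cos (a * t)) / t\<^sup>2 \<partial>lborel) = (\<integral>t. a\<^sup>2 * fejer (a * t) \<partial>lborel)"
    using ae by (intro integral_cong_AE) auto
  also have "\<dots> = a\<^sup>2 * (\<integral>t. fejer (a * t) \<partial>lborel)"
    by simp
  also have "\<dots> = \<bar>a\<bar> * fejer_mass"
    using lborel_integral_real_affine[of a fejer 0]
    by (cases "a = 0") (auto simp: fejer_mass_def power2_eq_square abs_if field_simps)
  finally show "(\<integral>t. (1 - cos (a * t)) / t\<^sup>2 \<partial>lborel) = \<bar>a\<bar> * fejer_mass" .
qed

text \<open>Product-to-sum turns the cosine transform into three integrals known by scaling.\<close>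
lemma integral_fejer_cos:
  "(\<integral>t. fejer t * cos (\<xi> * t) \<partial>lborel) = fejer_mass * tent \<xi>"
proof -
  let ?h = "\<lambda>a t::real. (1 - cos (a * t)) / t\<^sup>2"
  let ?H = "\<lambda>t. (1/2) * ?h (1+\<xi>) t + (1/2) * ?h (1-\<xi>) t - ?h \<xi> t"
  have ptwise: "fejer t * cos (\<xi> * t) = ?H t" if "t \<noteq> 0" for t
  proof -
    have "cos ((1+\<xi>) * t) = cos t * cos (\<xi>*t) - sin t * sin (\<xi>*t)"
         "cos ((1-\<xi>) * t) = cos t * cos (\<xi>*t) + sin t * sin (\<xi>*t)"
      by (simp_all add: algebra_simps cos_add cos_diff)
    then show ?thesis
      using that by (simp add: fejer_def divide_simps) (simp add: algebra_simps)
  qed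
  have ae: "AE t in lborel. ?H t = fejer t * cos (\<xi> * t)"
    using AE_lborel_singleton[of "0::real"] by eventually_elim (simp add: ptwise)
  note int = integrable_one_minus_cos[of "1+\<xi>"] integrable_one_minus_cos[of "1-\<xi>"] integrable_one_minus_cos[of \<xi>]
  have "(\<integral>t. fejer t * cos (\<xi> * t) \<partial>lborel) = (\<integral>t. ?H t \<partial>lborel)"
    using ae by (intro integral_cong_AE) auto
  also have "\<dots> = (1/2) * (\<bar>1+\<xi>\<bar> * fejer_mass) + (1/2) * (\<bar>1-\<xi>\<bar> * fejer_mass) - \<bar>\<xi>\<bar> * fejer_mass"
    using int by (simp only: integral_one_minus_cos Bochner_Integration.integral_diff Bochner_Integration.integral_add integrable_mult_right Bochner_Integration.integrable_add integral_mult_right_zero)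
  \<comment> \<open>The tent is half the second difference of the absolute value with step
    1.\<close>
  also have "\<dots> = fejer_mass * tent \<xi>"
    by (auto simp: tent_def max_def abs_if field_simps)
  finally show "(\<integral>t. fejer t * cos (\<xi> * t) \<partial>lborel) = fejer_mass * tent \<xi>" .
qed

lemma integral_odd_eq_0:
  fixes f :: "real \<Rightarrow> real"
  assumes "\<And>x. f (- x) = - f x"
  shows "(\<integral>x. f x \<partial>lborel) = 0"
  using lborel_integral_real_affine[of "-1" f 0] assms by simp

text \<open>For even \<open>f\<close> the sine part of the integrand is odd and integrates to 0,
  which leaves the cosine transform.\<close>

lemma
  fixes f :: "real \<Rightarrow> real"
  assumes f: "integrable lborel f" and even: "\<And>x. f (- x) = f x"
  shows integrable_cis_times: "integrable lborel (\<lambda>t. cis (\<xi> * t) * complex_of_real (f t))"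
    and integral_cis_times_even:
      "(\<integral>t. cis (\<xi> * t) * complex_of_real (f t) \<partial>lborel) = complex_of_real (\<integral>t. f t * cos (\<xi> * t) \<partial>lborel)"
proof -
  have f_meas [measurable]: "f \<in> borel_measurable borel"
    using f by auto
  have intc: "integrable lborel (\<lambda>t. f t * cos (\<xi> * t))" and ints: "integrable lborel (\<lambda>t. f t * sin (\<xi> * t))"
    by (rule Bochner_Integration.integrable_bound[OF f]; simp add: abs_mult mult_left_le)+
  have eq: "(\<lambda>t. cis (\<xi> * t) * complex_of_real (f t)) =
      (\<lambda>t. complex_of_real (f t * cos (\<xi> * t)) + \<i> * complex_of_real (f t * sin (\<xi> * t)))"
    by (auto simp: complex_eq_iff)
  show "integrable lborel (\<lambda>t. cis (\<xi> * t) * complex_of_real (f t))"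
    unfolding eq using intc ints
    by (intro Bochner_Integration.integrable_add integrable_mult_right) (simp_all only: complex_of_real_integrable_eq)
  have "(\<integral>t. f t * sin (\<xi> * t) \<partial>lborel) = 0"
    by (rule integral_odd_eq_0) (simp add: even)
  then show "(\<integral>t. cis (\<xi> * t) * complex_of_real (f t) \<partial>lborel) = complex_of_real (\<integral>t. f t * cos (\<xi> * t) \<partial>lborel)"
    unfolding eq using intc ints
    by (subst Bochner_Integration.integral_add) (simp_all only: complex_of_real_integrable_eq integrable_mult_right integral_complex_of_real integral_mult_right_zero of_real_0 mult_zero_right add_0_right)
qed

lemma continuous_on_tent [continuous_intros]:
  "continuous_on S f \<Longrightarrow> continuous_on S (\<lambda>x. tent (f x))"
  unfolding tent_def by (intro continuous_intros)

lemma borel_measurable_tent [measurable]: "tent \<in> borel_measurable borel"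
  by (intro borel_measurable_continuous_onI continuous_intros)

lemma integrable_tent: "integrable lborel tent"
proof (rule Bochner_Integration.integrable_bound)
  show "integrable lborel (indicat_real {-1..1::real})"
    by (intro integrable_real_indicator) auto
  show "AE x in lborel. norm (tent x) \<le> norm (indicat_real {- 1..1} x)"
    by (auto simp: tent_def indicator_def)
qed simp

text \<open>Counterpart of \<open>integral_fejer_cos\<close>: with both transforms explicit, Fourier
  inversion for the kernel is a direct computation.\<close>

lemma integral_tent_cos: "(\<integral>t. tent t * cos (x * t) \<partial>lborel) = 2 * fejer x"
proof -
  let ?p = "\<lambda>t. (1 - t) * cos (x * t)" and ?m = "\<lambda>t. (1 + t) * cos (x * t)"
  have p: "(\<integral>t. indicator {0..1} t *\<^sub>R ?p t \<partial>lborel) = fejer x"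
  proof (cases "x = 0")
    case True
    have "(\<integral>t. indicator {0..1} t *\<^sub>R (1 - t) \<partial>lborel) = (1 - 1\<^sup>2 / 2) - (0 - 0\<^sup>2 / 2 :: real)"
      by (rule integral_FTC_atLeastAtMost)
         (auto intro!: continuous_intros derivative_eq_intros simp: has_real_derivative_iff_has_vector_derivative[symmetric])
    then show ?thesis by (simp add: True fejer_def)
  next
    case False
    \<comment> \<open>The antiderivative comes from integration by parts. It divides by x, hence the
      separate case x = 0.\<close>
    let ?F = "\<lambda>t. (1 - t) * sin (x * t) / x - cos (x * t) / x\<^sup>2"
    have "(\<integral>t. indicator {0..1} t *\<^sub>R ?p t \<partial>lborel) = ?F 1 - ?F 0"
      using False by (intro integral_FTC_atLeastAtMost)
         (auto intro!: continuous_intros derivative_eq_intros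
           simp: has_real_derivative_iff_has_vector_derivative[symmetric] field_simps power2_eq_square)
    then show ?thesis using False by (simp add: fejer_def diff_divide_distrib)
  qed
  have m: "(\<integral>t. indicator {-1..0} t *\<^sub>R ?m t \<partial>lborel) = fejer x"
  proof -
    have "(\<integral>t. indicator {-1..0} t *\<^sub>R ?m t \<partial>lborel) = (\<integral>t. indicator {-1..0} (- t) *\<^sub>R ?m (- t) \<partial>lborel)"
      using lborel_integral_real_affine[of "-1" "\<lambda>t. indicator {-1..0} t *\<^sub>R ?m t" 0] by simp
    also have "(\<lambda>t. indicator {-1..0} (- t) *\<^sub>R ?m (- t)) = (\<lambda>t. indicator {0..1} t *\<^sub>R ?p t)"
      by (auto simp: indicator_def)
    finally show ?thesis using p by simp
  qed
  \<comment> \<open>The two intervals overlap in 0, where the right side counts the tent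
    twice.\<close>
  have "AE t in lborel. tent t * cos (x * t) = indicator {0..1} t *\<^sub>R ?p t + indicator {-1..0} t *\<^sub>R ?m t"
    using AE_lborel_singleton[of "0::real"] by eventually_elim (auto simp: tent_def indicator_def)
  then have "(\<integral>t. tent t * cos (x * t) \<partial>lborel)
      = (\<integral>t. indicator {0..1} t *\<^sub>R ?p t + indicator {-1..0} t *\<^sub>R ?m t \<partial>lborel)"
    by (intro integral_cong_AE) auto
  also have "\<dots> = 2 * fejer x"
  proof -
    have "set_integrable lborel {0..1} ?p" "set_integrable lborel {-1..0} ?m"
      by (intro borel_integrable_atLeastAtMost' continuous_intros)+
    then show ?thesis
      using p m unfolding set_integrable_def by (subst Bochner_Integration.integral_add) auto
  qed
  finally show ?thesis .
qed

text \<open>Each term is dominated by an increment of \<open>arctan\<close> over an interval of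
  length 1. The increments telescope to at most pi, so the bound depends neither on x nor on
  N.\<close>

lemma sum_fejer_le:
  assumes "1 \<le> D"
  shows "(\<Sum>m<N. fejer ((x - real m) / D)) \<le> 12 * pi * D\<^sup>2"
proof -
  have D: "1 \<le> D\<^sup>2" using assms by simp
  have step: "fejer ((x - real m) / D) \<le> 12 * D\<^sup>2 * (arctan (real (Suc m) - x) - arctan (real m - x))" for m
  proof -
    let ?u = "real m - x"
    obtain z where z: "?u < z" "z < ?u + 1" and eq: "arctan (?u + 1) - arctan ?u = (?u + 1 - ?u) * inverse (1 + z\<^sup>2)"
      using MVT2[of ?u "?u + 1" arctan "\<lambda>z. inverse (1 + z\<^sup>2)"] DERIV_arctan by auto
    \<comment> \<open>The mean value point z lies within distance 1 of \<open>?u\<close>, so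
      \<open>1 + z\<^sup>2\<close> is at most 3 times \<open>1 + ?u\<^sup>2\<close>. Together with
      the 4 of \<open>fejer_le\<close> this produces the constant 12.\<close>
    have sq: "z\<^sup>2 \<le> 2 * ?u\<^sup>2 + 2"
    proof -
      have "z\<^sup>2 = (?u + (z - ?u))\<^sup>2" by simp
      also have "\<dots> \<le> 2 * ?u\<^sup>2 + 2 * (z - ?u)\<^sup>2"
        using sum_squares_ge_zero[of "?u - (z - ?u)" 0] by (simp add: power2_eq_square algebra_simps)
      also have "(z - ?u)\<^sup>2 \<le> 1" using z by (simp add: abs_square_le_1)
      finally show ?thesis by simp
    qed
    have "fejer ((x - real m) / D) \<le> 4 / (1 + ((x - real m) / D)\<^sup>2)"
      by (rule fejer_le)
    also have "\<dots> = 4 * D\<^sup>2 / (D\<^sup>2 + ?u\<^sup>2)"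
      using assms by (simp add: power_divide power2_commute[of x] field_simps)
    also have "\<dots> \<le> 4 * D\<^sup>2 / (1 + ?u\<^sup>2)"
      using D by (intro divide_left_mono mult_pos_pos) (auto intro!: add_pos_nonneg order_less_le_trans[OF zero_less_one] add_increasing2)
    also have "1 / (1 + ?u\<^sup>2) \<le> 3 / (1 + z\<^sup>2)"
    proof -
      have "0 < 1 + ?u\<^sup>2" "0 < 1 + z\<^sup>2" by (auto intro: add_pos_nonneg)
      moreover have "1 + z\<^sup>2 \<le> 3 * (1 + ?u\<^sup>2)" using sq zero_le_power2[of ?u] unfolding distrib_left by linarith
      ultimately show ?thesis by (simp add: divide_simps)
    qed
    then have "4 * D\<^sup>2 / (1 + ?u\<^sup>2) \<le> 4 * D\<^sup>2 * (3 / (1 + z\<^sup>2))"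
      by (metis mult_left_mono[of _ _ "4 * D\<^sup>2"] mult.right_neutral times_divide_eq_right zero_le_mult_iff zero_le_numeral zero_le_power2)
    also have "\<dots> = 12 * D\<^sup>2 * (arctan (real (Suc m) - x) - arctan ?u)"
      using eq by (simp add: divide_inverse algebra_simps)
    finally show ?thesis .
  qed
  have "(\<Sum>m<N. fejer ((x - real m) / D)) \<le> (\<Sum>m<N. 12 * D\<^sup>2 * (arctan (real (Suc m) - x) - arctan (real m - x)))"
    by (intro sum_mono step)
  also have "\<dots> = 12 * D\<^sup>2 * (arctan (real N - x) - arctan (- x))"
    by (subst sum_distrib_left[symmetric], subst sum_lessThan_telescope) simp
  also have "\<dots> \<le> 12 * D\<^sup>2 * pi"
    using arctan_ubound[of "real N - x"] arctan_lbound[of "-x"] by (intro mult_left_mono) auto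
  finally show ?thesis by (simp add: mult_ac)
qed

section \<open>Littlewood--Paley blocks of the tensor Fejer kernel\<close>

text \<open>Fubini for tensor products. \<open>lborel\<close> on the vector type is the image of a
  product measure indexed by basis vectors, so \<open>idx\<close> translates a basis vector back
  into its coordinate.\<close>

lemma
  fixes f :: "'d::finite \<Rightarrow> real \<Rightarrow> 'b::{real_normed_field,banach,second_countable_topology}"
  assumes f: "\<And>j. integrable lborel (f j)"
  shows integrable_lborel_vec_prod: "integrable lborel (\<lambda>x::real^'d. \<Prod>j\<in>UNIV. f j (x $ j))"
    and integral_lborel_vec_prod:
      "(\<integral>x. (\<Prod>j\<in>UNIV. f j (x $ j)) \<partial>(lborel :: (real^'d) measure)) = (\<Prod>j\<in>UNIV. \<integral>t. f j t \<partial>lborel)"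
proof -
  let ?e = "\<lambda>j::'d. axis j (1::real)"
  define idx where "idx = inv ?e"
  have inj: "inj ?e" by (auto simp: inj_on_def axis_eq_axis)
  then have idx: "idx (?e j) = j" for j unfolding idx_def by (rule inv_f_f)
  have Basis: "(Basis :: (real^'d) set) = range ?e" by (auto simp: Basis_vec_def)
  interpret product_sigma_finite "\<lambda>_::real^'d. lborel :: real measure" ..
  let ?P = "\<Pi>\<^sub>M b\<in>(Basis :: (real^'d) set). (lborel :: real measure)"
  let ?T = "\<lambda>F. \<Sum>b\<in>(Basis :: (real^'d) set). F b *\<^sub>R b"
  have T [measurable]: "?T \<in> ?P \<rightarrow>\<^sub>M borel" by measurable
  have comp: "?T F $ j = F (?e j)" for F :: "real^'d \<Rightarrow> real" and j
    by (simp add: cart_eq_inner_axis)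
  have f_meas [measurable]: "f j \<in> borel_measurable borel" for j using f[of j] by auto
  have meas [measurable]: "(\<lambda>x::real^'d. \<Prod>j\<in>UNIV. f j (x $ j)) \<in> borel_measurable borel"
    by (intro borel_measurable_prod measurable_compose[OF _ f_meas])
       (auto intro!: borel_measurable_continuous_onI continuous_intros)
  have prod: "(\<Prod>j\<in>UNIV. f j (?T F $ j)) = (\<Prod>b\<in>Basis. f (idx b) (F b))" for F
    unfolding comp unfolding Basis by (subst prod.reindex[OF inj]) (simp add: idx)
  have "integrable ?P (\<lambda>F. \<Prod>b\<in>Basis. f (idx b) (F b))"
    by (intro product_integrable_prod f finite_Basis)
  then show "integrable lborel (\<lambda>x::real^'d. \<Prod>j\<in>UNIV. f j (x $ j))"
    by (subst lborel_eq, subst integrable_distr_eq[OF T meas]) (simp only: prod)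
  have "(\<integral>x. (\<Prod>j\<in>UNIV. f j (x $ j)) \<partial>(lborel :: (real^'d) measure)) = (\<integral>F. (\<Prod>b\<in>Basis. f (idx b) (F b)) \<partial>?P)"
    by (subst lborel_eq, subst integral_distr[OF T meas]) (simp only: prod)
  also have "\<dots> = (\<Prod>b\<in>(Basis :: (real^'d) set). \<integral>t. f (idx b) t \<partial>lborel)"
    by (intro product_integral_prod f finite_Basis)
  also have "\<dots> = (\<Prod>j\<in>UNIV. \<integral>t. f j t \<partial>lborel)"
    unfolding Basis by (subst prod.reindex[OF inj]) (simp add: idx)
  finally show "(\<integral>x. (\<Prod>j\<in>UNIV. f j (x $ j)) \<partial>(lborel :: (real^'d) measure)) = (\<Prod>j\<in>UNIV. \<integral>t. f j t \<partial>lborel)" .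
qed

section \<open>Convolution with an inverse Fourier transform\<close>

lemma
  fixes h :: "'a::euclidean_space \<Rightarrow> 'b::{banach,second_countable_topology}"
  assumes [measurable]: "h \<in> borel_measurable borel"
  shows integral_lborel_reflect: "(\<integral>y. h (x - y) \<partial>lborel) = (\<integral>u. h u \<partial>lborel)"
    and integrable_lborel_reflect: "integrable lborel (\<lambda>y. h (x - y)) \<longleftrightarrow> integrable lborel h"
proof -
  have "lborel = distr lborel borel (\<lambda>y. x - y)"
    using lborel_affine[of "-1" x] by (simp add: density_1)
  then show "(\<integral>y. h (x - y) \<partial>lborel) = (\<integral>u. h u \<partial>lborel)" "integrable lborel (\<lambda>y. h (x - y)) \<longleftrightarrow> integrable lborel h"
    using integral_distr[of "\<lambda>y. x - y" lborel borel h] integrable_distr_eq[of "\<lambda>y. x - y" lborel borel h]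
    by simp_all
qed

text \<open>The product formula behind the blocks: convolving \<open>f\<close> with the inverse
  transform of \<open>g\<close> amounts to inverting \<open>g\<close> times the transform of
  \<open>f\<close>. It follows from Fubini after splitting the phase of y into the phases of x and
  of -(x - y).\<close>

lemma
  fixes f :: "real^'d \<Rightarrow> real" and g :: "real^'d \<Rightarrow> complex"
  assumes f: "integrable lborel f" and g: "integrable lborel g"
  shows integrable_mult_inv_fourier: "integrable lborel (\<lambda>y. complex_of_real (f (x - y)) * inv_fourier g y)"
    and integral_mult_inv_fourier:
      "(\<integral>y. complex_of_real (f (x - y)) * inv_fourier g y \<partial>lborel) =
        complex_of_real ((2 * pi) powr (- real CARD('d))) *
        (\<integral>\<xi>. cis (x \<bullet> \<xi>) * g \<xi> * (\<integral>u. cis (- (u \<bullet> \<xi>)) * complex_of_real (f u) \<partial>lborel) \<partial>lborel)"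
proof -
  let ?c = "complex_of_real ((2 * pi) powr (- real CARD('d)))"
  have f_meas [measurable]: "f \<in> borel_measurable borel" and g_meas [measurable]: "g \<in> borel_measurable borel"
    using f g by auto
  have cis_meas [measurable]: "cis \<in> borel_measurable borel"
    by (intro borel_measurable_continuous_onI continuous_intros)
  let ?F = "\<lambda>(y, \<xi>). complex_of_real (f (x - y)) * (cis (y \<bullet> \<xi>) * g \<xi>)"
  have fr: "integrable lborel (\<lambda>y. f (x - y))"
    using f by (simp add: integrable_lborel_reflect)
  have int: "integrable (lborel \<Otimes>\<^sub>M lborel) ?F"
  proof (rule lborel_pair.Fubini_integrable)
    show "?F \<in> borel_measurable (lborel \<Otimes>\<^sub>M lborel)" by measurable
    have "integrable lborel (\<lambda>y. \<bar>f (x - y)\<bar> * (\<integral>\<xi>. norm (g \<xi>) \<partial>lborel))"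
      using fr by simp
    then show "integrable lborel (\<lambda>y. \<integral>\<xi>. norm (?F (y, \<xi>)) \<partial>lborel)"
      by (simp add: norm_mult)
    have "integrable lborel (\<lambda>\<xi>. cis (y \<bullet> \<xi>) * g \<xi>)" for y
      by (rule Bochner_Integration.integrable_bound[OF g]) (auto simp: norm_mult)
    then show "AE y in lborel. integrable lborel (\<lambda>\<xi>. ?F (y, \<xi>))"
      by simp
  qed
  have eq: "complex_of_real (f (x - y)) * inv_fourier g y = ?c * (\<integral>\<xi>. ?F (y, \<xi>) \<partial>lborel)" for y
    by (simp add: inv_fourier_def)
  show "integrable lborel (\<lambda>y. complex_of_real (f (x - y)) * inv_fourier g y)"
    unfolding eq using lborel_pair.integrable_fst'[OF int] by (rule integrable_mult_right)
  have shift: "(\<integral>y. ?F (y, \<xi>) \<partial>lborel) = cis (x \<bullet> \<xi>) * g \<xi> * (\<integral>u. cis (- (u \<bullet> \<xi>)) * complex_of_real (f u) \<partial>lborel)" for \<xi>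
  proof -
    have "(\<integral>y. ?F (y, \<xi>) \<partial>lborel) = (\<integral>y. (cis (x \<bullet> \<xi>) * g \<xi>) * (cis (- ((x - y) \<bullet> \<xi>)) * complex_of_real (f (x - y))) \<partial>lborel)"
      by (intro Bochner_Integration.integral_cong refl)
         (simp add: inner_diff_left cis_mult[symmetric] mult_ac cis_mult)
    also have "\<dots> = (cis (x \<bullet> \<xi>) * g \<xi>) * (\<integral>y. cis (- ((x - y) \<bullet> \<xi>)) * complex_of_real (f (x - y)) \<partial>lborel)"
      by simp
    also have "(\<integral>y. cis (- ((x - y) \<bullet> \<xi>)) * complex_of_real (f (x - y)) \<partial>lborel) = (\<integral>u. cis (- (u \<bullet> \<xi>)) * complex_of_real (f u) \<partial>lborel)"
      by (rule integral_lborel_reflect[of "\<lambda>u. cis (- (u \<bullet> \<xi>)) * complex_of_real (f u)"]) measurable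
    finally show ?thesis .
  qed
  have "(\<integral>y. complex_of_real (f (x - y)) * inv_fourier g y \<partial>lborel) = ?c * (\<integral>y. \<integral>\<xi>. ?F (y, \<xi>) \<partial>lborel \<partial>lborel)"
    unfolding eq by simp
  also have "(\<integral>y. \<integral>\<xi>. ?F (y, \<xi>) \<partial>lborel \<partial>lborel) = (\<integral>\<xi>. \<integral>y. ?F (y, \<xi>) \<partial>lborel \<partial>lborel)"
    using lborel_pair.Fubini_integral[of "\<lambda>y \<xi>. ?F (y, \<xi>)"] int by simp
  finally show "(\<integral>y. complex_of_real (f (x - y)) * inv_fourier g y \<partial>lborel) = ?c *
        (\<integral>\<xi>. cis (x \<bullet> \<xi>) * g \<xi> * (\<integral>u. cis (- (u \<bullet> \<xi>)) * complex_of_real (f u) \<partial>lborel) \<partial>lborel)"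
    unfolding shift .
qed

section \<open>The tensor kernel and its Fourier transform\<close>

definition fejer_kernel :: "real^'d \<Rightarrow> real" where
  "fejer_kernel x = (\<Prod>j\<in>UNIV. fejer (x $ j / real CARD('d)))"

lemma fejer_kernel_nonneg: "0 \<le> fejer_kernel x"
  unfolding fejer_kernel_def by (intro prod_nonneg ballI fejer_nonneg)

lemma continuous_on_fejer_kernel: "continuous_on S fejer_kernel"
  unfolding fejer_kernel_def by (intro continuous_intros) auto

lemma borel_measurable_fejer_kernel [measurable]: "fejer_kernel \<in> borel_measurable borel"
  by (intro borel_measurable_continuous_onI continuous_on_fejer_kernel)

lemma integrable_fejer_scaled: "D \<noteq> 0 \<Longrightarrow> integrable lborel (\<lambda>t. fejer (t / D))"
  using lborel_integrable_real_affine[OF integrable_fejer, of "1 / D" 0] by simp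

lemma integrable_fejer_kernel: "integrable lborel (fejer_kernel :: real^'d \<Rightarrow> real)"
  unfolding fejer_kernel_def by (intro integrable_lborel_vec_prod integrable_fejer_scaled) simp

lemma cis_sum: "finite I \<Longrightarrow> cis (\<Sum>i\<in>I. f i) = (\<Prod>i\<in>I. cis (f i))"
  by (induction I rule: finite_induct) (auto simp: cis_mult[symmetric])

text \<open>The Fourier transform of \<open>fejer_kernel\<close>; in each coordinate the dilation by
  the dimension contributes the factor in front and the one inside the tent.\<close>

definition tent_kernel :: "real^'d \<Rightarrow> real" where
  "tent_kernel \<xi> = (\<Prod>j\<in>UNIV. real CARD('d) * fejer_mass * tent (real CARD('d) * \<xi> $ j))"

lemma fourier_fejer_kernel:
  fixes \<xi> :: "real^'d"
  shows "(\<integral>u. cis (- (u \<bullet> \<xi>)) * complex_of_real (fejer_kernel u) \<partial>lborel) = complex_of_real (tent_kernel \<xi>)"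
proof -
  let ?D = "real CARD('d)"
  have D: "0 < ?D" by simp
  have even: "fejer (- (t / ?D)) = fejer (t / ?D)" for t
    by (simp add: fejer_def)
  have one: "integrable lborel (\<lambda>t. cis (a * t) * complex_of_real (fejer (t / ?D)))"
    "(\<integral>t. cis (- (a * t)) * complex_of_real (fejer (t / ?D)) \<partial>lborel) = complex_of_real (?D * fejer_mass * tent (?D * a))" for a
  proof -
    show "integrable lborel (\<lambda>t. cis (a * t) * complex_of_real (fejer (t / ?D)))"
      by (rule integrable_cis_times) (simp_all add: integrable_fejer_scaled even)
    have "(\<integral>t. cis (- (a * t)) * complex_of_real (fejer (t / ?D)) \<partial>lborel) = complex_of_real (\<integral>t. fejer (t / ?D) * cos (- a * t) \<partial>lborel)"
      using integral_cis_times_even[of "\<lambda>t. fejer (t / ?D)" "- a"] by (simp add: integrable_fejer_scaled even)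
    also have "(\<integral>t. fejer (t / ?D) * cos (- a * t) \<partial>lborel) = ?D * (\<integral>t. fejer t * cos ((?D * a) * t) \<partial>lborel)"
      using lborel_integral_real_affine[of ?D "\<lambda>t. fejer (t / ?D) * cos (- a * t)" 0] D by (simp add: mult_ac)
    finally show "(\<integral>t. cis (- (a * t)) * complex_of_real (fejer (t / ?D)) \<partial>lborel) = complex_of_real (?D * fejer_mass * tent (?D * a))"
      by (simp add: integral_fejer_cos)
  qed
  have "(\<integral>u. cis (- (u \<bullet> \<xi>)) * complex_of_real (fejer_kernel u) \<partial>lborel)
      = (\<integral>u. (\<Prod>j\<in>UNIV. cis (- \<xi> $ j * u $ j) * complex_of_real (fejer (u $ j / ?D))) \<partial>(lborel :: (real^'d) measure))"
    by (intro Bochner_Integration.integral_cong refl)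
       (simp add: prod.distrib fejer_kernel_def inner_vec_def cis_sum[symmetric] sum_negf mult.commute)
  also have "\<dots> = complex_of_real (tent_kernel \<xi>)"
    using integral_lborel_vec_prod[of "\<lambda>j t. cis (- \<xi> $ j * t) * complex_of_real (fejer (t / ?D))", OF one(1)]
    by (simp add: one(2) tent_kernel_def)
  finally show ?thesis .
qed

text \<open>In each coordinate, substitution cancels the factor d, and
  \<open>integral_tent_cos\<close> supplies the 2.\<close>

lemma inverse_fourier_tent_kernel:
  fixes x :: "real^'d"
  shows "(\<integral>\<xi>. cis (x \<bullet> \<xi>) * complex_of_real (tent_kernel \<xi>) \<partial>lborel) =
    complex_of_real ((2 * fejer_mass) ^ CARD('d) * fejer_kernel x)"
proof -
  let ?D = "real CARD('d)"
  let ?t = "\<lambda>t. ?D * fejer_mass * tent (?D * t)"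
  have D: "0 < ?D" by simp
  have int: "integrable lborel ?t"
    using lborel_integrable_real_affine[OF integrable_tent, of ?D 0] by simp
  have one: "integrable lborel (\<lambda>t. cis (a * t) * complex_of_real (?t t))"
    "(\<integral>t. cis (a * t) * complex_of_real (?t t) \<partial>lborel) = complex_of_real (2 * fejer_mass * fejer (a / ?D))" for a
  proof -
    show "integrable lborel (\<lambda>t. cis (a * t) * complex_of_real (?t t))"
      by (rule integrable_cis_times[OF int]) (simp add: tent_def)
    have "(\<integral>t. cis (a * t) * complex_of_real (?t t) \<partial>lborel) = complex_of_real (\<integral>t. ?t t * cos (a * t) \<partial>lborel)"
      by (rule integral_cis_times_even[OF int]) (simp add: tent_def)
    also have "(\<integral>t. ?t t * cos (a * t) \<partial>lborel) = fejer_mass * (\<integral>t. tent t * cos ((a / ?D) * t) \<partial>lborel)"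
      using lborel_integral_real_affine[of ?D "\<lambda>t. tent t * cos ((a / ?D) * t)" 0] D by (simp add: mult_ac)
    finally show "(\<integral>t. cis (a * t) * complex_of_real (?t t) \<partial>lborel) = complex_of_real (2 * fejer_mass * fejer (a / ?D))"
      by (simp only: integral_tent_cos, simp only: mult_ac)
  qed
  have "(\<integral>\<xi>. cis (x \<bullet> \<xi>) * complex_of_real (tent_kernel \<xi>) \<partial>lborel)
      = (\<integral>\<xi>. (\<Prod>j\<in>UNIV. cis (x $ j * \<xi> $ j) * complex_of_real (?t (\<xi> $ j))) \<partial>(lborel :: (real^'d) measure))"
    by (intro Bochner_Integration.integral_cong refl)
       (simp add: prod.distrib tent_kernel_def inner_vec_def cis_sum[symmetric])
  also have "\<dots> = complex_of_real ((2 * fejer_mass) ^ CARD('d) * fejer_kernel x)"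
    using integral_lborel_vec_prod[of "\<lambda>j t. cis (x $ j * t) * complex_of_real (?t t)", OF one(1)]
    unfolding one(2) by (simp add: fejer_kernel_def prod.distrib power_mult_distrib)
  finally show ?thesis .
qed

text \<open>This is what the dilation by d achieves: if every coordinate were below 1/d in absolute
  value, the l1 norm, and with it the Euclidean norm, would be below 1. Hence some tent factor
  vanishes.\<close>

lemma tent_kernel_eq_0:
  fixes \<xi> :: "real^'d"
  assumes "1 \<le> norm \<xi>"
  shows "tent_kernel \<xi> = 0"
proof -
  have "\<exists>j. 1 \<le> real CARD('d) * \<bar>\<xi> $ j\<bar>"
  proof (rule ccontr)
    assume "\<nexists>j. 1 \<le> real CARD('d) * \<bar>\<xi> $ j\<bar>"
    then have "\<bar>\<xi> $ j\<bar> < 1 / real CARD('d)" for j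
      by (auto simp: not_le field_simps)
    then have "(\<Sum>j\<in>UNIV. \<bar>\<xi> $ j\<bar>) < (\<Sum>j\<in>(UNIV :: 'd set). 1 / real CARD('d))"
      by (intro sum_strict_mono) auto
    then show False using norm_le_l1_cart[of \<xi>] assms by simp
  qed
  then obtain j where "1 \<le> real CARD('d) * \<bar>\<xi> $ j\<bar>" by blast
  then have "tent (real CARD('d) * \<xi> $ j) = 0" by (simp add: tent_def abs_mult)
  then show ?thesis unfolding tent_kernel_def by (intro prod_zero) auto
qed

section \<open>The Littlewood--Paley cutoffs acting on the kernel\<close>

locale lp_cutoff =
  fixes \<phi>0 :: "real^'d \<Rightarrow> real"
  assumes smooth: "smooth_fun \<phi>0"
    and one: "\<And>x. norm x \<le> 1 \<Longrightarrow> \<phi>0 x = 1"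
    and zero: "\<And>x. norm x \<ge> 3/2 \<Longrightarrow> \<phi>0 x = 0"
begin

lemma continuous_on_cutoff: "continuous_on S \<phi>0"
  using smooth by cases (auto intro: continuous_on_subset)

lemma integrable_lp_phi: "integrable lborel (\<lambda>\<xi>. complex_of_real (lp_phi \<phi>0 k \<xi>))"
proof -
  have cont: "continuous_on S (\<lambda>x. \<phi>0 (a *\<^sub>R x))" for S a
    by (rule continuous_on_compose2[OF continuous_on_cutoff[of UNIV]]) (auto intro!: continuous_intros)
  have c: "integrable lborel (\<lambda>x. \<phi>0 (a *\<^sub>R x))" if "a > 0" for a
  proof -
    have "integrable lborel (\<lambda>x. indicator (cball 0 (3 / (2 * a))) x *\<^sub>R \<phi>0 (a *\<^sub>R x))"
      by (intro borel_integrable_compact cont) simp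
    also have "(\<lambda>x. indicator (cball 0 (3 / (2 * a))) x *\<^sub>R \<phi>0 (a *\<^sub>R x)) = (\<lambda>x. \<phi>0 (a *\<^sub>R x))"
      using that zero by (auto simp: fun_eq_iff indicator_def field_simps not_le)
    finally show ?thesis .
  qed
  show ?thesis
    \<comment> \<open>The dilation 1 serves k = 0; the other two are the two terms whose difference
      is the cutoff of index k.\<close>
    using c[of 1] c[of "2 powr (1 - real k) / 2"] c[of "2 powr (1 - real k)"]
    by (cases "k = 0") (simp_all add: lp_phi_def Let_def complex_of_real_integrable_eq del: of_real_diff)
qed

text \<open>On the unit ball \<open>\<phi>0\<close> is 1 at every contraction of the argument, so
  the difference defining the cutoff cancels for positive k. Outside the unit ball the kernel's
  transform is 0.\<close>

lemma lp_phi_mult_tent_kernel: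
  "lp_phi \<phi>0 k \<xi> * tent_kernel \<xi> = (if k = 0 then tent_kernel \<xi> else 0)"
proof (cases "norm \<xi> \<le> 1")
  case True
  have "norm (2 powr (1 - real k) *\<^sub>R \<xi>) \<le> 1" if "k \<noteq> 0"
    using True that powr_mono[of "1 - real k" 0 2] by (simp add: mult_le_one)
  then show ?thesis
    using True one by (auto simp: lp_phi_def Let_def)
qed (simp add: tent_kernel_eq_0)

text \<open>After the product formula only the inversion of \<open>tent_kernel\<close> remains, at k
  = 0. The factor is the normalisation \<open>(2 * pi) powr (- d)\<close> times the d-th power of
  \<open>2 * fejer_mass\<close>.\<close>

lemma lp_block_fejer_kernel:
  "lp_block \<phi>0 k fejer_kernel x =
    (if k = 0 then complex_of_real ((fejer_mass / pi) ^ CARD('d) * fejer_kernel x) else 0)"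
proof -
  have "lp_block \<phi>0 k fejer_kernel x = complex_of_real ((2 * pi) powr (- real CARD('d))) *
    (\<integral>\<xi>. cis (x \<bullet> \<xi>) * complex_of_real (lp_phi \<phi>0 k \<xi>) * complex_of_real (tent_kernel \<xi>) \<partial>lborel)"
    unfolding lp_block_def
    by (simp add: integral_mult_inv_fourier[OF integrable_fejer_kernel integrable_lp_phi] fourier_fejer_kernel)
  also have "\<dots> = complex_of_real ((2 * pi) powr (- real CARD('d))) *
    (if k = 0 then (\<integral>\<xi>. cis (x \<bullet> \<xi>) * complex_of_real (tent_kernel \<xi>) \<partial>lborel) else 0)"
    by (simp add: mult.assoc of_real_mult[symmetric] lp_phi_mult_tent_kernel del: of_real_mult)
  also have "\<dots> = (if k = 0 then complex_of_real ((2 * pi) powr (- real CARD('d)) * ((2 * fejer_mass) ^ CARD('d) * fejer_kernel x)) else 0)"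
    by (simp add: inverse_fourier_tent_kernel)
  also have "(2 * pi) powr (- real CARD('d)) * ((2 * fejer_mass) ^ CARD('d) * fejer_kernel x) = (fejer_mass / pi) ^ CARD('d) * fejer_kernel x"
    by (simp add: powr_minus powr_realpow power_mult_distrib power_divide divide_simps)
  finally show ?thesis .
qed

lemma lp_block_sum_translates:
  assumes "finite I"
  shows "lp_block \<phi>0 k (\<lambda>x. \<Sum>i\<in>I. b i * fejer_kernel (x - z i)) x =
    (if k = 0 then complex_of_real ((fejer_mass / pi) ^ CARD('d) * (\<Sum>i\<in>I. b i * fejer_kernel (x - z i))) else 0)"
proof -
  let ?K = "inv_fourier (\<lambda>\<xi>. complex_of_real (lp_phi \<phi>0 k \<xi>))"
  have "lp_block \<phi>0 k (\<lambda>x. \<Sum>i\<in>I. b i * fejer_kernel (x - z i)) x =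
    (\<integral>y. (\<Sum>i\<in>I. complex_of_real (b i) * (complex_of_real (fejer_kernel (x - z i - y)) * ?K y)) \<partial>lborel)"
    by (simp add: lp_block_def sum_distrib_right mult.assoc diff_diff_eq add.commute)
  also have "\<dots> = (\<Sum>i\<in>I. complex_of_real (b i) * lp_block \<phi>0 k fejer_kernel (x - z i))"
    using integrable_mult_inv_fourier[OF integrable_fejer_kernel integrable_lp_phi]
    by (subst Bochner_Integration.integral_sum) (simp_all add: lp_block_def)
  finally show ?thesis
    by (simp add: lp_block_fejer_kernel sum_distrib_left mult_ac)
qed

end

section \<open>Lattice sums in the Besov unit ball\<close>

text \<open>Jensen's inequality for the p-th power with the weights \<open>v i / ?V\<close>; the
  total weight then enters with exponent p - 1 and is bounded by C.\<close>

lemma sum_powr_le: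
  fixes c v :: "'i \<Rightarrow> real"
  assumes I: "finite I" and c: "\<And>i. i \<in> I \<Longrightarrow> 0 < c i" and v: "\<And>i. i \<in> I \<Longrightarrow> 0 \<le> v i"
    and C: "(\<Sum>i\<in>I. v i) \<le> C" and p: "1 \<le> p"
  shows "(\<Sum>i\<in>I. c i * v i) powr p \<le> C powr (p - 1) * (\<Sum>i\<in>I. c i powr p * v i)"
proof -
  let ?V = "\<Sum>i\<in>I. v i"
  have V: "0 \<le> ?V" using v by (intro sum_nonneg)
  show ?thesis
  proof (cases "?V = 0")
    case True
    then have "v i = 0" if "i \<in> I" for i
      using that I v by (simp add: sum_nonneg_eq_0_iff)
    then show ?thesis by simp
  next
    case False
    then have V: "0 < ?V" and I': "I \<noteq> {}" using V by auto
    let ?m = "\<Sum>i\<in>I. (v i / ?V) *\<^sub>R c i"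
    have jensen: "?m powr p \<le> (\<Sum>i\<in>I. (v i / ?V) * (c i powr p))"
      using I I' c v V
      by (intro convex_on_sum[OF _ _ powr_convex[OF p]]) (auto simp: sum_divide_distrib[symmetric])
    have m: "?m = (\<Sum>i\<in>I. c i * v i) / ?V"
      by (simp add: sum_divide_distrib mult.commute)
    have "(\<Sum>i\<in>I. c i * v i) powr p = ?V powr p * ?m powr p"
      unfolding m using V c v by (subst powr_divide) (auto intro!: sum_nonneg mult_nonneg_nonneg simp: less_imp_le)
    also have "\<dots> \<le> ?V powr p * (\<Sum>i\<in>I. (v i / ?V) * (c i powr p))"
      by (intro mult_left_mono jensen) simp
    also have "\<dots> = ?V powr (p - 1) * (\<Sum>i\<in>I. c i powr p * v i)"
      using V by (simp add: powr_diff sum_distrib_left mult_ac)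
    also have "\<dots> \<le> C powr (p - 1) * (\<Sum>i\<in>I. c i powr p * v i)"
      using V C p v by (intro mult_right_mono powr_mono2) (auto intro!: sum_nonneg)
    finally show ?thesis .
  qed
qed

definition lattice_pt :: "('d \<Rightarrow> nat) \<Rightarrow> real^'d" where
  "lattice_pt n = (\<chi> j. real (n j))"

text \<open>All terms are nonnegative, so the index set may be enlarged to a cube, over which the
  sum factors into one-dimensional lattice sums.\<close>

lemma sum_fejer_kernel_le:
  fixes x :: "real^'d"
  assumes "finite I"
  shows "(\<Sum>n\<in>I. fejer_kernel (x - lattice_pt n)) \<le> (12 * pi * (real CARD('d))\<^sup>2) ^ CARD('d)"
proof -
  let ?D = "real CARD('d)"
  have "\<exists>N. \<forall>n\<in>I. \<forall>j. n j < N"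
  proof (intro exI ballI allI)
    fix n j assume "n \<in> I"
    then have "n j \<le> Max ((\<lambda>(n, j). n j) ` (I \<times> UNIV))"
      using assms by (intro Max_ge) (auto simp: image_iff)
    then show "n j < Suc (Max ((\<lambda>(n, j). n j) ` (I \<times> UNIV)))" by simp
  qed
  then obtain N where "\<forall>n\<in>I. \<forall>j. n j < N" by blast
  then have sub: "I \<subseteq> PiE UNIV (\<lambda>_. {..<N})" by auto
  have "(\<Sum>n\<in>I. fejer_kernel (x - lattice_pt n)) \<le> (\<Sum>n\<in>PiE UNIV (\<lambda>_. {..<N}). fejer_kernel (x - lattice_pt n))"
    by (intro sum_mono2 sub finite_PiE fejer_kernel_nonneg) auto
  also have "\<dots> = (\<Prod>j\<in>UNIV. \<Sum>m<N. fejer ((x $ j - real m) / ?D))"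
    by (subst prod_sum_PiE) (auto simp: fejer_kernel_def lattice_pt_def)
  also have "\<dots> \<le> (\<Prod>j\<in>(UNIV :: 'd set). 12 * pi * ?D\<^sup>2)"
    by (intro prod_mono conjI sum_nonneg fejer_nonneg sum_fejer_le) (simp add: Suc_leI)
  finally show ?thesis by simp
qed

lemma fejer_kernel_diff_commute: "fejer_kernel (x - y) = fejer_kernel (y - x)"
proof -
  have "fejer (- t) = fejer t" for t by (simp add: fejer_def)
  then have "fejer ((x $ j - y $ j) / D) = fejer ((y $ j - x $ j) / D)" for j D
    by (metis minus_diff_eq minus_divide_left)
  then show ?thesis by (simp add: fejer_kernel_def)
qed

lemma fejer_kernel_le: "fejer_kernel (x :: real^'d) \<le> 4 ^ CARD('d)"
proof -
  have "fejer t \<le> 4" for t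
    by (rule order_trans[OF fejer_le]) (simp add: divide_le_eq add_pos_nonneg)
  then have "fejer_kernel x \<le> (\<Prod>j\<in>(UNIV :: 'd set). 4)"
    unfolding fejer_kernel_def by (intro prod_mono) (auto simp: fejer_nonneg)
  then show ?thesis by simp
qed

lemma enn_powr_le_1:
  assumes "x \<le> 1" "0 \<le> r"
  shows "enn_powr x r \<le> 1"
proof -
  have x: "x \<noteq> \<top>" using assms by (auto simp: top_unique)
  then have "enn2real x \<le> 1" using assms by (simp add: enn2real_leI)
  then have "enn2real x powr r \<le> 1"
    using assms powr_mono2[of r "enn2real x" 1] by simp
  then show ?thesis using x by (simp add: enn_powr_def)
qed

lemma enn_powr_0: "enn_powr 0 r = 0"
  by (simp add: enn_powr_def)

text \<open>For nonnegative \<open>a\<close> this says that the l^p norm over I is at most 1; with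
  bound 1 no root has to be taken.\<close>

definition unit_lp :: "ereal \<Rightarrow> 'i set \<Rightarrow> ('i \<Rightarrow> real) \<Rightarrow> bool" where
  "unit_lp p I a \<longleftrightarrow> (if p = \<infinity> then \<forall>i\<in>I. a i \<le> 1 else (\<Sum>i\<in>I. a i powr real_of_ereal p) \<le> 1)"

lemma Lp_norm_zero: "0 < p \<Longrightarrow> Lp_norm p (\<lambda>x. 0) = 0"
  using esssup_I[of "\<lambda>x. 0::ennreal" lborel 0]
  by (auto simp: Lp_norm_def enn_powr_0)

text \<open>One constant that dominates both the lattice sums and the integral of the kernel and is
  at least 1; the type argument carries the dimension.\<close>

definition kernel_bound :: "'d::finite itself \<Rightarrow> real" where
  "kernel_bound _ = 1 + (12 * pi * (real CARD('d))\<^sup>2) ^ CARD('d) + (\<integral>x. fejer_kernel (x :: real^'d) \<partial>lborel)"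

lemma kernel_bound_ge:
  shows "1 \<le> kernel_bound TYPE('d::finite)"
    and "(12 * pi * (real CARD('d))\<^sup>2) ^ CARD('d) \<le> kernel_bound TYPE('d)"
    and "(\<integral>x. fejer_kernel (x :: real^'d) \<partial>lborel) \<le> kernel_bound TYPE('d)"
proof -
  have "0 \<le> (\<integral>x. fejer_kernel (x :: real^'d) \<partial>lborel)"
    by (intro integral_nonneg_AE) (simp add: fejer_kernel_nonneg)
  moreover have "0 \<le> (12 * pi * (real CARD('d))\<^sup>2) ^ CARD('d)" by simp
  ultimately show "1 \<le> kernel_bound TYPE('d::finite)"
    "(12 * pi * (real CARD('d))\<^sup>2) ^ CARD('d) \<le> kernel_bound TYPE('d)"
    "(\<integral>x. fejer_kernel (x :: real^'d) \<partial>lborel) \<le> kernel_bound TYPE('d)"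
    unfolding kernel_bound_def by linarith+
qed

text \<open>For infinite p the bound on lattice sums suffices. For finite p, Jensen's inequality
  bounds the power of the sum pointwise, and integrating the kernels leaves the sum of the powers of
  \<open>a\<close>. Injectivity of \<open>z\<close> turns the sum over I into one over distinct
  lattice points.\<close>

lemma Lp_norm_sum_translates_le:
  fixes z :: "'i \<Rightarrow> 'd::finite \<Rightarrow> nat"
  assumes p: "1 \<le> p" and I: "finite I" "inj_on z I"
    and a: "\<And>i. i \<in> I \<Longrightarrow> 0 < a i" "unit_lp p I a"
    and b: "\<And>i. i \<in> I \<Longrightarrow> \<bar>b i\<bar> \<le> a i"
    and K: "0 \<le> K" "K * kernel_bound TYPE('d) \<le> 1"
  shows "Lp_norm p (\<lambda>x::real^'d. complex_of_real (K * (\<Sum>i\<in>I. b i * fejer_kernel (x - lattice_pt (z i))))) \<le> 1"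
proof -
  let ?C = "kernel_bound TYPE('d)"
  let ?k = "\<lambda>i x. fejer_kernel (x - lattice_pt (z i)) :: real"
  let ?f = "\<lambda>x. K * (\<Sum>i\<in>I. b i * ?k i x)"
  have C: "1 \<le> ?C" by (rule kernel_bound_ge)
  have k_meas [measurable]: "?k i \<in> borel_measurable borel" for i
    by (intro borel_measurable_continuous_onI continuous_on_compose2[OF continuous_on_fejer_kernel[of UNIV]])
       (auto intro!: continuous_intros)
  have sum_k: "(\<Sum>i\<in>I. ?k i x) \<le> ?C" for x
  proof -
    have "(\<Sum>i\<in>I. ?k i x) = (\<Sum>n\<in>z ` I. fejer_kernel (x - lattice_pt n))"
      using I by (simp add: sum.reindex)
    also have "\<dots> \<le> ?C"
      using I by (intro order_trans[OF sum_fejer_kernel_le kernel_bound_ge(2)]) simp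
    finally show ?thesis .
  qed
  have f_le: "\<bar>?f x\<bar> \<le> K * (\<Sum>i\<in>I. a i * ?k i x)" for x
  proof -
    have "\<bar>\<Sum>i\<in>I. b i * ?k i x\<bar> \<le> (\<Sum>i\<in>I. a i * ?k i x)"
      using b by (intro order_trans[OF sum_abs] sum_mono)
        (auto simp: abs_mult fejer_kernel_nonneg intro!: mult_right_mono)
    then show ?thesis using K by (simp add: abs_mult mult_left_mono)
  qed
  show ?thesis
  proof (cases "p = \<infinity>")
    case True
    have "\<bar>?f x\<bar> \<le> 1" for x
    proof -
      have "(\<Sum>i\<in>I. a i * ?k i x) \<le> (\<Sum>i\<in>I. ?k i x)"
        using a True by (intro sum_mono mult_left_le_one_le fejer_kernel_nonneg) (auto simp: unit_lp_def less_imp_le)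
      then have "K * (\<Sum>i\<in>I. a i * ?k i x) \<le> K * ?C"
        using sum_k[of x] K by (intro mult_left_mono) linarith+
      then show ?thesis using f_le[of x] K by linarith
    qed
    then have "esssup lborel (\<lambda>x. ennreal (norm (complex_of_real (?f x)))) \<le> 1"
      by (intro esssup_I) (auto simp del: of_real_mult)
    then show ?thesis using True by (simp add: Lp_norm_def del: of_real_mult)
  next
    case False
    define r where "r = real_of_ereal p"
    have r: "1 \<le> r" and pr: "p = ereal r"
      using p False by (cases p; auto simp: r_def one_ereal_def)+
    have ar: "(\<Sum>i\<in>I. a i powr r) \<le> 1" using a False by (simp add: unit_lp_def r_def)
    have int_k: "integrable lborel (?k i)" and integral_k: "(\<integral>x. ?k i x \<partial>lborel) \<le> ?C" for i
    proof -
      \<comment> \<open>The kernel is even, so a translate is also a reflection and the reflection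
        lemmas apply.\<close>
      have "?k i = (\<lambda>x. fejer_kernel (lattice_pt (z i) - x))"
        by (simp add: fejer_kernel_diff_commute)
      then show "integrable lborel (?k i)" "(\<integral>x. ?k i x \<partial>lborel) \<le> ?C"
        using integrable_fejer_kernel kernel_bound_ge(3)[where 'd='d]
        by (simp_all only: integrable_lborel_reflect[OF borel_measurable_fejer_kernel]
          integral_lborel_reflect[OF borel_measurable_fejer_kernel])
    qed
    \<comment> \<open>The exponent r - 1 on \<open>?C\<close> stems from Jensen's inequality with
      the lattice sum as total weight; integrating the kernel adds one more \<open>?C\<close>, which
      gives \<open>(K * ?C) powr r\<close> in all.\<close>
    let ?g = "\<lambda>x. K powr r * (?C powr (r - 1) * (\<Sum>i\<in>I. a i powr r * ?k i x))"
    have "norm (complex_of_real (?f x)) powr r \<le> ?g x" for x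
    proof -
      have "norm (complex_of_real (?f x)) powr r \<le> (K * (\<Sum>i\<in>I. a i * ?k i x)) powr r"
        using f_le r unfolding norm_of_real by (intro powr_mono2) auto
      also have "\<dots> = K powr r * (\<Sum>i\<in>I. a i * ?k i x) powr r"
        by (rule powr_mult)
      also have "\<dots> \<le> ?g x"
        using a r sum_k by (intro mult_left_mono sum_powr_le I) (auto simp: fejer_kernel_nonneg)
      finally show ?thesis .
    qed
    then have "(\<integral>\<^sup>+x. ennreal (norm (complex_of_real (?f x)) powr r) \<partial>lborel) \<le> (\<integral>\<^sup>+x. ennreal (?g x) \<partial>lborel)"
      by (intro nn_integral_mono ennreal_leI)
    also have "\<dots> = ennreal (\<integral>x. ?g x \<partial>lborel)"
      using int_k by (intro nn_integral_eq_integral)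
        (auto intro!: AE_I2 mult_nonneg_nonneg sum_nonneg simp: fejer_kernel_nonneg)
    also have "(\<integral>x. ?g x \<partial>lborel) = K powr r * (?C powr (r - 1) * (\<Sum>i\<in>I. a i powr r * (\<integral>x. ?k i x \<partial>lborel)))"
      using int_k by (simp add: Bochner_Integration.integral_sum)
    also have "\<dots> \<le> K powr r * (?C powr (r - 1) * (\<Sum>i\<in>I. a i powr r * ?C))"
      using integral_k by (intro mult_left_mono sum_mono) auto
    also have "\<dots> \<le> K powr r * (?C powr (r - 1) * ?C)"
      using ar C by (intro mult_left_mono) (auto simp: sum_distrib_right[symmetric])
    also have "\<dots> = (K * ?C) powr r"
      using C K by (simp add: powr_diff powr_mult)
    also have "\<dots> \<le> 1"
      using K C r powr_mono2[of r "K * ?C" 1] by simp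
    finally have "(\<integral>\<^sup>+x. ennreal (norm (complex_of_real (?f x)) powr r) \<partial>lborel) \<le> 1"
      by (simp add: ennreal_leI)
    then show ?thesis
      using r unfolding Lp_norm_def pr by (simp add: enn_powr_le_1 del: of_real_mult)
  qed
qed

context lp_cutoff
begin

text \<open>The weight of block 0 is 2 to the power 0, so for every \<open>s\<close> the sum or
  supremum over blocks is governed by one L^p norm. The factor \<open>\<kappa>\<close> compensates
  for the constant of block 0 and for \<open>kernel_bound\<close>.\<close>

lemma sum_translates_in_besov_unit_ball:
  fixes z :: "'i \<Rightarrow> 'd::finite \<Rightarrow> nat"
  assumes p: "1 \<le> p" and q: "1 \<le> q" and I: "finite I" "inj_on z I"
    and a: "\<And>i. i \<in> I \<Longrightarrow> 0 < a i" "unit_lp p I a"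
    and b: "\<And>i. i \<in> I \<Longrightarrow> \<bar>b i\<bar> \<le> a i"
    and \<kappa>: "0 \<le> \<kappa>" "(fejer_mass / pi) ^ CARD('d) * \<kappa> * kernel_bound TYPE('d) \<le> 1"
  shows "(\<lambda>x. \<Sum>i\<in>I. b i * (\<kappa> * fejer_kernel (x - lattice_pt (z i)))) \<in> besov_unit_ball \<phi>0 s p q"
proof -
  let ?f = "\<lambda>x. \<Sum>i\<in>I. b i * (\<kappa> * fejer_kernel (x - lattice_pt (z i)))"
  have f: "?f = (\<lambda>x. \<Sum>i\<in>I. (b i * \<kappa>) * fejer_kernel (x - lattice_pt (z i)))"
    by (simp add: mult.assoc)
  have "continuous_on UNIV ?f"
    by (intro continuous_intros continuous_on_compose2[OF continuous_on_fejer_kernel[of UNIV]]) auto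
  moreover have "bounded (range ?f)"
  proof -
    have "norm (?f x) \<le> (\<Sum>i\<in>I. \<bar>b i\<bar> * (\<kappa> * 4 ^ CARD('d)))" for x
      using \<kappa> by (intro order_trans[OF norm_sum] sum_mono)
        (auto simp: abs_mult fejer_kernel_nonneg intro!: mult_left_mono fejer_kernel_le)
    then show ?thesis by (auto simp: bounded_iff)
  qed
  moreover have "besov_norm \<phi>0 s p q ?f \<le> 1"
  proof -
    have b0: "lp_block \<phi>0 0 ?f = (\<lambda>x. complex_of_real (((fejer_mass / pi) ^ CARD('d) * \<kappa>) * (\<Sum>i\<in>I. b i * fejer_kernel (x - lattice_pt (z i)))))"
      unfolding f by (intro ext, unfold lp_block_sum_translates[OF I(1)]) (simp add: sum_distrib_left mult_ac)
    have bk: "lp_block \<phi>0 k ?f = (\<lambda>x. 0)" if "k \<noteq> 0" for k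
      unfolding f using that by (intro ext, unfold lp_block_sum_translates[OF I(1)]) simp
    have L0: "Lp_norm p (lp_block \<phi>0 0 ?f) \<le> 1"
      unfolding b0 using fejer_mass_nonneg \<kappa> by (intro Lp_norm_sum_translates_le[OF p I a b]) auto
    have p0: "0 < p" using p by (rule order_less_le_trans[rotated]) simp
    have Lk: "Lp_norm p (lp_block \<phi>0 k ?f) = 0" if "k \<noteq> 0" for k
      using bk[OF that] p0 by (simp add: Lp_norm_zero)
    show ?thesis
    proof (cases "q = \<infinity>")
      case True
      have "ennreal (2 powr (real k * s)) * Lp_norm p (lp_block \<phi>0 k ?f) \<le> 1" for k
        using L0 Lk by (cases "k = 0") auto
      then show ?thesis using True by (auto simp: besov_norm_def intro!: SUP_least)
    next
      case False
      let ?r = "real_of_ereal q"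
      have r: "1 \<le> ?r" using q False by (cases q) (auto simp: one_ereal_def)
      have "(\<Sum>k. ennreal (2 powr (real k * s * ?r)) * enn_powr (Lp_norm p (lp_block \<phi>0 k ?f)) ?r)
          = (\<Sum>k\<in>{0}. ennreal (2 powr (real k * s * ?r)) * enn_powr (Lp_norm p (lp_block \<phi>0 k ?f)) ?r)"
        by (intro suminf_finite) (auto simp: Lk enn_powr_0)
      also have "\<dots> \<le> 1" using L0 r by (simp add: enn_powr_le_1)
      finally show ?thesis using False r by (simp add: besov_norm_def enn_powr_le_1)
    qed
  qed
  ultimately show ?thesis by (simp add: besov_unit_ball_def)
qed

end

section \<open>Unbounded Brownian bridges\<close>

text \<open>The density is positive, so if the tail had measure 0, the interval from 1 to 2 would be
  a Lebesgue null set.\<close>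

lemma std_normal_tail_pos: "0 < measure (density lborel std_normal_density) {x. 1 \<le> \<bar>x\<bar>}"
proof -
  interpret prob_space "density lborel std_normal_density"
    by (rule prob_space_normal_density) simp
  let ?N = "density lborel std_normal_density"
  have sets: "{x. 1 \<le> \<bar>x\<bar>} \<in> sets ?N" by measurable
  have "emeasure ?N {x. 1 \<le> \<bar>x\<bar>} \<noteq> 0"
  proof
    assume "emeasure ?N {x. 1 \<le> \<bar>x\<bar>} = 0"
    then have "AE x in lborel. ennreal (std_normal_density x) * indicator {x. 1 \<le> \<bar>x\<bar>} x = 0"
      using sets by (simp add: emeasure_density nn_integral_0_iff_AE)
    then have "AE x in lborel. x \<notin> {1..2::real}"
    proof eventually_elim
      case (elim x)
      then show ?case using normal_density_pos[of 1 0 x] by (auto simp: indicator_def split: if_splits)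
    qed
    then have "emeasure lborel {1..2::real} = 0"
      by (subst (asm) AE_iff_null_sets[symmetric]) auto
    then show False by (subst (asm) emeasure_lborel_Icc) auto
  qed
  then show ?thesis
    by (simp add: emeasure_eq_measure zero_less_measure_iff)
qed

definition normal_tail :: real where
  "normal_tail = measure (density lborel std_normal_density) {x. 1 \<le> \<bar>x\<bar>}"

lemma normal_tail_pos: "0 < normal_tail"
  unfolding normal_tail_def by (rule std_normal_tail_pos)

lemma normal_tail_le_1: "normal_tail \<le> 1"
  unfolding normal_tail_def
  by (intro prob_space.prob_le_1 prob_space_normal_density) simp

text \<open>Dividing by the standard deviation reduces to the standard normal law, so the bound does
  not depend on v. In the degenerate case v = 0 the event is the whole space.\<close>

lemma prob_ge_sd_centered_normal:
  assumes M: "prob_space M" and X [measurable]: "X \<in> borel_measurable M"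
    and distr: "distr M borel X = centered_normal v" and "0 \<le> v"
  shows "normal_tail \<le> measure M {\<omega> \<in> space M. sqrt v \<le> \<bar>X \<omega>\<bar>}"
proof -
  interpret prob_space M by fact
  show ?thesis
  proof (cases "v = 0")
    case True
    then show ?thesis using normal_tail_le_1 by (simp add: prob_space)
  next
    case False
    then have sv: "0 < sqrt v" using \<open>0 \<le> v\<close> by simp
    have "distributed M lborel X (normal_density 0 (sqrt v))"
      using distr False by (auto simp: distributed_def centered_normal_def cong: distr_cong)
    then have "distributed M lborel (\<lambda>x. (X x - 0) / sqrt v) std_normal_density"
      using normal_standard_normal_convert[OF sv, of X 0] by simp
    then have d: "distr M lborel (\<lambda>x. X x / sqrt v) = density lborel std_normal_density"
      by (simp add: distributed_def)
    have "normal_tail = measure (distr M lborel (\<lambda>x. X x / sqrt v)) {x. 1 \<le> \<bar>x\<bar>}"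
      by (simp add: d normal_tail_def)
    also have "\<dots> = measure M ((\<lambda>x. X x / sqrt v) -` {x. 1 \<le> \<bar>x\<bar>} \<inter> space M)"
      by (rule measure_distr) auto
    also have "(\<lambda>x. X x / sqrt v) -` {x. 1 \<le> \<bar>x\<bar>} \<inter> space M = {\<omega> \<in> space M. sqrt v \<le> \<bar>X \<omega>\<bar>}"
      using sv by (auto simp: abs_divide divide_simps)
    finally show ?thesis by simp
  qed
qed

text \<open>Reverse Markov: the weighted count has mean at least \<open>2\<theta>\<close> times its maximum.\<close>
lemma (in prob_space) prob_weighted_count_ge:
  assumes I: "finite I" and w: "\<And>i. i \<in> I \<Longrightarrow> 0 \<le> w i"
    and V: "\<And>i. i \<in> I \<Longrightarrow> V i \<in> events" "\<And>i. i \<in> I \<Longrightarrow> 2 * \<theta> \<le> prob (V i)"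
    and \<theta>: "0 \<le> \<theta>" "\<theta> \<le> 1"
  shows "\<theta> \<le> prob {\<omega> \<in> space M. \<theta> * (\<Sum>i\<in>I. w i) \<le> (\<Sum>i\<in>I. w i * indicator (V i) \<omega>)}"
proof -
  let ?W = "\<Sum>i\<in>I. w i" and ?X = "\<lambda>\<omega>. \<Sum>i\<in>I. w i * indicat_real (V i) \<omega>"
  let ?A = "{\<omega> \<in> space M. \<theta> * ?W \<le> ?X \<omega>}"
  have X [measurable]: "?X \<in> borel_measurable M" using V by auto
  have A: "?A \<in> events" by measurable
  have W: "0 \<le> ?W" using w by (intro sum_nonneg)
  have int: "integrable M (\<lambda>\<omega>. w i * indicat_real (V i) \<omega>)" if "i \<in> I" for i
    using V(1)[OF that] by (intro integrable_mult_right integrable_real_indicator) (auto simp: emeasure_eq_measure)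
  have "2 * \<theta> * ?W \<le> (\<Sum>i\<in>I. w i * prob (V i))"
    unfolding sum_distrib_left using w V by (intro sum_mono) (metis mult.commute mult_left_mono)
  also have "\<dots> = expectation ?X"
    using int V by (subst Bochner_Integration.integral_sum) (auto intro!: sum.cong)
  \<comment> \<open>The weighted count never exceeds the total weight, and off \<open>?A\<close> it
    stays below \<open>\<theta>\<close> times that weight.\<close>
  also have "\<dots> \<le> expectation (\<lambda>\<omega>. \<theta> * ?W + ?W * indicat_real ?A \<omega>)"
  proof (rule integral_mono)
    show "integrable M ?X" using int by (rule Bochner_Integration.integrable_sum)
    show "integrable M (\<lambda>\<omega>. \<theta> * ?W + ?W * indicat_real ?A \<omega>)"
      using A by (intro Bochner_Integration.integrable_add integrable_mult_right integrable_real_indicator)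
        (auto simp: emeasure_eq_measure)
    fix \<omega> assume \<omega>: "\<omega> \<in> space M"
    have "?X \<omega> \<le> ?W" using w by (intro sum_mono) (auto simp: indicator_def)
    moreover have "0 \<le> \<theta> * ?W" using W \<theta> by simp
    ultimately show "?X \<omega> \<le> \<theta> * ?W + ?W * indicat_real ?A \<omega>"
      using \<omega> by (cases "\<omega> \<in> ?A") simp_all
  qed
  also have "\<dots> = \<theta> * ?W + ?W * prob ?A"
    using A by (subst Bochner_Integration.integral_add)
      (auto simp: prob_space emeasure_eq_measure intro!: integrable_mult_right integrable_real_indicator)
  finally have le: "\<theta> * ?W \<le> prob ?A * ?W" by (simp add: algebra_simps)
  show ?thesis
  proof (cases "?W = 0")
    case True
    then have "w i = 0" if "i \<in> I" for i
      using that I w by (simp add: sum_nonneg_eq_0_iff)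
    then have "?A = space M" by auto
    then show ?thesis using \<theta> by (metis prob_space)
  next
    case False
    then show ?thesis using le W by (simp add: mult_le_cancel_right)
  qed
qed

section \<open>Sizes, linearity and unboundedness of bridge paths\<close>

lemma brownian_bridge_prob_ge_sd:
  assumes bb: "brownian_bridge P F M G" and f: "f \<in> F"
  shows "normal_tail \<le> measure M {\<omega> \<in> space M. sqrt (\<integral>x. (f x - (\<integral>y. f y \<partial>P))\<^sup>2 \<partial>P) \<le> \<bar>G f \<omega>\<bar>}"
proof (rule prob_ge_sd_centered_normal)
  show "prob_space M" "G f \<in> borel_measurable M"
    using bb f by (auto simp: brownian_bridge_def)
  have *: "\<And>S a. finite S \<Longrightarrow> S \<subseteq> F \<Longrightarrow> distr M borel (\<lambda>\<omega>. \<Sum>f\<in>S. a f * G f \<omega>) =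
        centered_normal (\<integral> x. (\<Sum>f\<in>S. a f * (f x - (\<integral> y. f y \<partial>P)))\<^sup>2 \<partial>P)"
    using bb unfolding brownian_bridge_def by blast
  show "distr M borel (G f) = centered_normal (\<integral>x. (f x - (\<integral>y. f y \<partial>P))\<^sup>2 \<partial>P)"
    using *[of "{f}" "\<lambda>_. 1"] f by simp
  show "0 \<le> (\<integral>x. (f x - (\<integral>y. f y \<partial>P))\<^sup>2 \<partial>P)"
    by (intro integral_nonneg_AE) simp
qed

text \<open>The defect of linearity has variance zero.\<close>
lemma brownian_bridge_linear_AE:
  assumes bb: "brownian_bridge P F M G"
    and I: "finite I" and h: "\<And>i. i \<in> I \<Longrightarrow> h i \<in> F" "\<And>i. i \<in> I \<Longrightarrow> integrable P (h i)"
    and f: "(\<lambda>x. \<Sum>i\<in>I. b i * h i x) \<in> F"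
  shows "AE \<omega> in M. G (\<lambda>x. \<Sum>i\<in>I. b i * h i x) \<omega> = (\<Sum>i\<in>I. b i * G (h i) \<omega>)"
proof -
  let ?f = "\<lambda>x. \<Sum>i\<in>I. b i * h i x"
  define S where "S = insert ?f (h ` I)"
  \<comment> \<open>The \<open>h i\<close> may coincide with each other or with \<open>?f\<close>,
    so the coefficients have to be collected per function.\<close>
  define a where "a g = (if g = ?f then 1 else 0) - (\<Sum>i\<in>I. if g = h i then b i else 0)" for g
  have S: "finite S" "S \<subseteq> F" using I h f by (auto simp: S_def)
  \<comment> \<open>Stated for arbitrary L because it is applied twice: to the centred value of g at
    x, and to \<open>G g \<omega>\<close>.\<close>
  have sum: "(\<Sum>g\<in>S. a g * L g) = L ?f - (\<Sum>i\<in>I. b i * L (h i))" for L :: "('a \<Rightarrow> real) \<Rightarrow> real"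
  proof -
    have "(\<Sum>g\<in>S. a g * L g) = (\<Sum>g\<in>S. if g = ?f then L g else 0) - (\<Sum>g\<in>S. \<Sum>i\<in>I. if g = h i then b i * L g else 0)"
      unfolding a_def sum_subtractf[symmetric] sum_distrib_right left_diff_distrib
      by (intro sum.cong refl arg_cong2[where f="(-)"]) auto
    also have "(\<Sum>g\<in>S. if g = ?f then L g else 0) = L ?f"
      using S by (subst sum.delta) (auto simp: S_def)
    also have "(\<Sum>g\<in>S. \<Sum>i\<in>I. if g = h i then b i * L g else 0) = (\<Sum>i\<in>I. \<Sum>g\<in>S. if g = h i then b i * L g else 0)"
      by (rule sum.swap)
    also have "\<dots> = (\<Sum>i\<in>I. b i * L (h i))"
      using S by (intro sum.cong refl, subst sum.delta) (auto simp: S_def)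
    finally show ?thesis .
  qed
  have "(\<integral>y. ?f y \<partial>P) = (\<Sum>i\<in>I. b i * (\<integral>y. h i y \<partial>P))"
    using h by (subst Bochner_Integration.integral_sum) auto
  then have "(\<Sum>g\<in>S. a g * (g x - (\<integral> y. g y \<partial>P))) = 0" for x
    unfolding sum by (simp add: right_diff_distrib sum_subtractf)
  moreover have "distr M borel (\<lambda>\<omega>. \<Sum>g\<in>S. a g * G g \<omega>) =
        centered_normal (\<integral> x. (\<Sum>g\<in>S. a g * (g x - (\<integral> y. g y \<partial>P)))\<^sup>2 \<partial>P)"
    using bb S unfolding brownian_bridge_def by blast
  ultimately have "distr M borel (\<lambda>\<omega>. \<Sum>g\<in>S. a g * G g \<omega>) = return borel 0"
    by (simp add: centered_normal_def)
  moreover have "AE x in return borel (0::real). x = 0"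
    by (subst AE_return) auto
  ultimately have "AE x in distr M borel (\<lambda>\<omega>. \<Sum>g\<in>S. a g * G g \<omega>). x = 0"
    by (simp only:)
  moreover have [measurable]: "(\<lambda>\<omega>. \<Sum>g\<in>S. a g * G g \<omega>) \<in> borel_measurable M"
    using bb S by (auto simp: brownian_bridge_def intro!: borel_measurable_sum borel_measurable_times)
  ultimately have "AE \<omega> in M. (\<Sum>g\<in>S. a g * G g \<omega>) = 0"
    by (subst (asm) AE_distr_iff) auto
  then show ?thesis
    unfolding sum by eventually_elim simp
qed

text \<open>On a bounded path respecting the countably many linear relations involved, every sum
  \<open>X k\<close> is the value of the bridge at some signed combination, so all the
  \<open>X k\<close> have a common bound almost surely. Yet for each m the probability that m is
  such a bound stays away from 1. Continuity from below makes these contradictory.\<close>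

lemma not_pregaussian_if_large_sums:
  assumes P: "prob_space P"
    and large: "\<And>B::real. \<exists>(I :: 'i set) h a. finite I \<and> (\<forall>i\<in>I. 0 \<le> a i \<and> h i \<in> F) \<and>
      (\<forall>b. (\<forall>i\<in>I. \<bar>b i\<bar> \<le> a i) \<longrightarrow> (\<lambda>x. \<Sum>i\<in>I. b i * h i x) \<in> F) \<and>
      B \<le> (\<Sum>i\<in>I. a i * sqrt (\<integral>x. (h i x - (\<integral>y. h i y \<partial>P))\<^sup>2 \<partial>P))"
  shows "\<not> pregaussian TYPE('w) P F"
proof
  assume "pregaussian TYPE('w) P F"
  then obtain M :: "'w measure" and G where F: "\<forall>f\<in>F. f \<in> borel_measurable P \<and> integrable P (\<lambda>x. (f x)\<^sup>2)"
    and bb: "brownian_bridge P F M G"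
    and bdd: "\<forall>\<omega>\<in>space M. bounded ((\<lambda>f. G f \<omega>) ` F)"
    unfolding pregaussian_def by blast
  interpret M: prob_space M using bb by (simp add: brownian_bridge_def)
  interpret P: prob_space P by fact
  have G [measurable]: "G f \<in> borel_measurable M" if "f \<in> F" for f
    using bb that by (simp add: brownian_bridge_def)
  have intF: "integrable P f" if "f \<in> F" for f
    using F that P.square_integrable_imp_integrable by blast
  \<comment> \<open>Half the tail probability, as \<open>prob_weighted_count_ge\<close> asks for
    events of probability at least \<open>2 * \<theta>\<close>.\<close>
  define \<theta> where "\<theta> = normal_tail / 2"
  have \<theta>: "0 < \<theta>" "\<theta> \<le> 1" using normal_tail_pos normal_tail_le_1 by (auto simp: \<theta>_def)
  define sd where "sd f = sqrt (\<integral>x. (f x - (\<integral>y. f y \<partial>P))\<^sup>2 \<partial>P)" for f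
  \<comment> \<open>The threshold is such that a fraction \<open>\<theta>\<close> of the weighted
    sum is at least k + 1 and thus strictly above k.\<close>
  define good where "good k I h a \<longleftrightarrow> finite I \<and> (\<forall>i\<in>I. 0 \<le> a i \<and> h i \<in> F) \<and>
      (\<forall>b. (\<forall>i\<in>I. \<bar>b i\<bar> \<le> a i) \<longrightarrow> (\<lambda>x. \<Sum>i\<in>I. b i * h i x) \<in> F) \<and>
      (real k + 1) / \<theta> \<le> (\<Sum>i\<in>I. a i * sd (h i))"
    for k :: nat and I :: "'i set" and h :: "'i \<Rightarrow> 'a \<Rightarrow> real" and a :: "'i \<Rightarrow> real"
  have "\<exists>I h a. good k I h a" for k
    using large[of "(real k + 1) / \<theta>"] unfolding good_def sd_def .
  then obtain I h a where good: "good k (I k) (h k) (a k)" for k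
    by metis
  have I: "finite (I k)" for k
    using good[of k] unfolding good_def by (elim conjE)
  have a: "0 \<le> a k i" and h: "h k i \<in> F" if "i \<in> I k" for k i
    using good[of k] that unfolding good_def by (elim conjE; blast)+
  have comb: "(\<lambda>x. \<Sum>i\<in>I k. b i * h k i x) \<in> F" if "\<And>i. i \<in> I k \<Longrightarrow> \<bar>b i\<bar> \<le> a k i" for k b
    using good[of k] that unfolding good_def by (elim conjE) blast
  have W: "(real k + 1) / \<theta> \<le> (\<Sum>i\<in>I k. a k i * sd (h k i))" for k
    using good[of k] unfolding good_def by (elim conjE)
  define X where "X k \<omega> = (\<Sum>i\<in>I k. a k i * \<bar>G (h k i) \<omega>\<bar>)" for k \<omega>
  have X [measurable]: "X k \<in> borel_measurable M" for k
    unfolding X_def using h by (intro borel_measurable_sum borel_measurable_times borel_measurable_abs G) auto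
  define B where "B m = {\<omega> \<in> space M. \<forall>k. X k \<omega> \<le> real m}" for m :: nat
  have B: "B m \<in> M.events" for m unfolding B_def by measurable
  have "M.prob (B m) \<le> 1 - \<theta>" for m
  proof -
    let ?V = "\<lambda>i. {\<omega> \<in> space M. sd (h m i) \<le> \<bar>G (h m i) \<omega>\<bar>}"
    let ?w = "\<lambda>i. a m i * sd (h m i)"
    let ?A = "{\<omega> \<in> space M. \<theta> * (\<Sum>i\<in>I m. ?w i) \<le> (\<Sum>i\<in>I m. ?w i * indicator (?V i) \<omega>)}"
    have sd: "0 \<le> sd f" for f by (auto simp: sd_def intro!: integral_nonneg_AE)
    have V: "?V i \<in> M.events" if "i \<in> I m" for i
      using G[OF h[OF that]] by measurable
    have "\<theta> \<le> M.prob ?A"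
      using a sd V \<theta> brownian_bridge_prob_ge_sd[OF bb h, folded sd_def]
      by (intro M.prob_weighted_count_ge I) (auto simp: \<theta>_def)
    moreover have "(\<lambda>\<omega>. \<Sum>i\<in>I m. ?w i * indicator (?V i) \<omega>) \<in> borel_measurable M"
      using V by (intro borel_measurable_sum borel_measurable_times borel_measurable_const borel_measurable_indicator)
    then have A: "?A \<in> M.events" by (rule borel_measurable_le[OF borel_measurable_const])
    \<comment> \<open>The family with index m is tested against the bound m: on \<open>?A\<close>
      its sum \<open>X m\<close> is at least m + 1.\<close>
    moreover have "B m \<inter> ?A = {}"
    proof (intro equals0I)
      fix \<omega> assume "\<omega> \<in> B m \<inter> ?A"
      then have \<omega>: "\<omega> \<in> space M" "X m \<omega> \<le> real m"
        and ge: "\<theta> * (\<Sum>i\<in>I m. ?w i) \<le> (\<Sum>i\<in>I m. ?w i * indicator (?V i) \<omega>)"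
        by (auto simp: B_def)
      have "real m + 1 \<le> \<theta> * (\<Sum>i\<in>I m. ?w i)"
        using W[of m] \<theta> by (simp add: divide_le_eq mult.commute)
      also note ge
      also have "(\<Sum>i\<in>I m. ?w i * indicator (?V i) \<omega>) \<le> X m \<omega>"
        unfolding X_def using a by (intro sum_mono) (auto simp: indicator_def mult_left_mono)
      finally show False using \<omega> by simp
    qed
    then have "M.prob (B m \<union> ?A) = M.prob (B m) + M.prob ?A"
      by (rule M.finite_measure_Union[OF B A])
    ultimately have "M.prob (B m) + \<theta> \<le> M.prob (B m \<union> ?A)"
      by (simp only: add_left_mono)
    then show ?thesis using M.prob_le_1[of "B m \<union> ?A"] by linarith
  qed
  moreover have "(\<lambda>m. M.prob (B m)) \<longlonglongrightarrow> M.prob (\<Union>m. B m)"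
  proof (rule M.finite_Lim_measure_incseq)
    show "range B \<subseteq> M.events" using B by blast
    show "incseq B"
    proof (intro monoI subsetI)
      fix m n \<omega> assume "m \<le> n" "\<omega> \<in> B m"
      then have "\<omega> \<in> space M" "X k \<omega> \<le> real n" for k
        unfolding B_def by (auto intro: order_trans[of _ "real m"])
      then show "\<omega> \<in> B n" by (simp add: B_def)
    qed
  qed
  ultimately have "M.prob (\<Union>m. B m) \<le> 1 - \<theta>"
    by (intro LIMSEQ_le_const2) auto
  moreover have "AE \<omega> in M. \<omega> \<in> (\<Union>m. B m)"
  proof -
    \<comment> \<open>T is the set of indices with positive sign. There are finitely many sign
      patterns for each k, so linearity holds for all of them at once almost surely.\<close>
    define b where "b k T i = (if i \<in> T then a k i else - a k i)" for k T i
    have comb': "(\<lambda>x. \<Sum>i\<in>I k. b k T i * h k i x) \<in> F" for k T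
      using a by (intro comb) (auto simp: b_def)
    have "AE \<omega> in M. \<forall>k. \<forall>T\<in>Pow (I k). G (\<lambda>x. \<Sum>i\<in>I k. b k T i * h k i x) \<omega> = (\<Sum>i\<in>I k. b k T i * G (h k i) \<omega>)"
      using I h comb' intF
      by (subst AE_all_countable, intro allI AE_finite_allI brownian_bridge_linear_AE[OF bb]) auto
    then show ?thesis
      using AE_space
    proof eventually_elim
      case (elim \<omega>)
      obtain C where C: "\<And>f. f \<in> F \<Longrightarrow> \<bar>G f \<omega>\<bar> \<le> C"
        using bdd elim(2) unfolding bounded_iff by force
      obtain m :: nat where m: "C \<le> real m" using real_arch_simple by blast
      have "X k \<omega> \<le> real m" for k
      proof -
        \<comment> \<open>The signs are those of the path itself, which turns every term into
          \<open>a\<close> times an absolute value.\<close>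
        define T where "T = {i \<in> I k. 0 \<le> G (h k i) \<omega>}"
        have "X k \<omega> = (\<Sum>i\<in>I k. b k T i * G (h k i) \<omega>)"
          unfolding X_def by (intro sum.cong) (auto simp: b_def T_def)
        also have "\<dots> = G (\<lambda>x. \<Sum>i\<in>I k. b k T i * h k i x) \<omega>"
          using elim(1) by (auto simp: T_def)
        also have "\<dots> \<le> real m" using C[OF comb'[of k T]] m by linarith
        finally show ?thesis .
      qed
      then show ?case using elim(2) by (auto simp: B_def)
    qed
  qed
  then have "M.prob (\<Union>m. B m) = 1"
    using B by (intro iffD2[OF M.prob_eq_1]) auto
  ultimately show False using \<theta> by simp
qed

section \<open>Variances of translates and dyadic boxes\<close>

text \<open>The kernel takes the values \<open>\<beta>\<close> at 0 and 0 at v, so every constant m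
  is at least \<open>\<beta> / 2\<close> away from one of them; by continuity
  \<open>\<beta> / 4\<close> remains on a ball.\<close>

lemma fejer_kernel_far_from_const:
  obtains \<alpha> \<rho> and v :: "real^'d" where "0 < \<alpha>" "0 < \<rho>"
    "\<And>m. \<exists>e\<in>{0, v}. \<forall>y\<in>ball e \<rho>. \<alpha> \<le> (fejer_kernel y - m)\<^sup>2"
proof -
  \<comment> \<open>After division by the dimension every coordinate is 2 pi, a zero of
    \<open>fejer\<close>.\<close>
  define v :: "real^'d" where "v = (\<chi> j. 2 * pi * real CARD('d))"
  define \<beta> where "\<beta> = fejer_kernel (0 :: real^'d)"
  have \<beta>: "0 < \<beta>"
    unfolding \<beta>_def fejer_kernel_def by (intro prod_pos) (simp add: fejer_def)
  have v0: "fejer_kernel v = 0"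
    unfolding fejer_kernel_def v_def by (intro prod_zero) (auto simp: fejer_def)
  have cont: "\<exists>\<rho>>0. \<forall>y\<in>ball e \<rho>. \<bar>fejer_kernel y - fejer_kernel e\<bar> < \<beta> / 4" for e :: "real^'d"
    using continuous_on_fejer_kernel[of UNIV, unfolded continuous_on_iff, rule_format, of e "\<beta> / 4"] \<beta>
    by (auto simp: dist_real_def dist_commute)
  obtain \<rho>1 where \<rho>1: "0 < \<rho>1" "\<forall>y\<in>ball (0 :: real^'d) \<rho>1. \<bar>fejer_kernel y - \<beta>\<bar> < \<beta> / 4"
    using cont[of 0] unfolding \<beta>_def by blast
  obtain \<rho>2 where \<rho>2: "0 < \<rho>2" "\<forall>y\<in>ball v \<rho>2. \<bar>fejer_kernel y\<bar> < \<beta> / 4"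
    using cont[of v] unfolding v0 by auto
  show thesis
  proof (rule that[of "(\<beta> / 4)\<^sup>2" "min \<rho>1 \<rho>2" v])
    show "0 < (\<beta> / 4)\<^sup>2" "0 < min \<rho>1 \<rho>2" using \<beta> \<rho>1 \<rho>2 by auto
    fix m :: real
    show "\<exists>e\<in>{0, v}. \<forall>y\<in>ball e (min \<rho>1 \<rho>2). (\<beta> / 4)\<^sup>2 \<le> (fejer_kernel y - m)\<^sup>2"
    proof (cases "m \<le> \<beta> / 2")
      case True
      have "(\<beta> / 4)\<^sup>2 \<le> (fejer_kernel y - m)\<^sup>2" if "y \<in> ball 0 (min \<rho>1 \<rho>2)" for y :: "real^'d"
      proof -
        have "\<bar>fejer_kernel y - \<beta>\<bar> < \<beta> / 4" using that \<rho>1 by auto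
        then have "\<beta> / 4 \<le> fejer_kernel y - m" using True by linarith
        then show ?thesis using \<beta> by (intro power_mono) auto
      qed
      then show ?thesis by blast
    next
      case False
      have "(\<beta> / 4)\<^sup>2 \<le> (fejer_kernel y - m)\<^sup>2" if "y \<in> ball v (min \<rho>1 \<rho>2)" for y :: "real^'d"
      proof -
        have "\<bar>fejer_kernel y\<bar> < \<beta> / 4" using that \<rho>2 by auto
        then have "\<beta> / 4 \<le> m - fejer_kernel y" using False by linarith
        then have "(\<beta> / 4)\<^sup>2 \<le> (m - fejer_kernel y)\<^sup>2" using \<beta> by (intro power_mono) auto
        then show ?thesis by (simp add: power2_commute)
      qed
      then show ?thesis by blast
    qed
  qed
qed

lemma measure_ball_weighted_ge:
  fixes w :: "real^'d \<Rightarrow> real" and v :: "real^'d"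
  assumes [measurable]: "w \<in> borel_measurable borel" and c: "0 < c" and t: "0 \<le> t" and \<rho>: "0 < \<rho>"
    and w: "\<And>x. c * (1 + (norm x)\<^sup>2) powr (- t) \<le> w x"
  obtains \<eta> where "0 < \<eta>"
    "\<And>z e. e \<in> {0, v} \<Longrightarrow> ennreal (\<eta> * (1 + (norm z)\<^sup>2) powr (- t)) \<le> emeasure (density lborel (\<lambda>x. ennreal (w x))) (ball (z + e) \<rho>)"
proof -
  \<comment> \<open>Every point of the ball around z + e lies within R of z, for both choices of
    e.\<close>
  define R where "R = norm v + \<rho>"
  define B where "B = 2 + 2 * R\<^sup>2"
  define V where "V = measure lborel (ball (0 :: real^'d) \<rho>)"
  have V: "0 < V"
    using \<rho> by (simp add: V_def content_ball_pos)
  have B: "2 \<le> B" by (simp add: B_def)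
  show thesis
  proof (rule that[of "c * B powr (- t) * V"])
    show "0 < c * B powr (- t) * V" using c B V by simp
    fix z e :: "real^'d" assume e: "e \<in> {0, v}"
    let ?l = "c * (B powr (- t) * (1 + (norm z)\<^sup>2) powr (- t))"
    have l: "0 \<le> ?l" using c by simp
    have le: "?l \<le> w x" if "x \<in> ball (z + e) \<rho>" for x
    proof -
      have "norm x \<le> norm z + R"
      proof -
        have "norm e \<le> norm v" using e by auto
        moreover have "norm (x - (z + e)) < \<rho>"
          using that by (simp add: dist_norm norm_minus_commute)
        moreover have "norm x \<le> norm z + norm e + norm (x - (z + e))"
          using norm_triangle_ineq[of "z + e" "x - (z + e)"] norm_triangle_ineq[of z e] by simp
        ultimately show ?thesis unfolding R_def by linarith
      qed
      then have "1 + (norm x)\<^sup>2 \<le> 1 + (norm z + R)\<^sup>2"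
        by (simp add: power_mono)
      \<comment> \<open>The right side minus the left is
        \<open>1 + (norm z - R)\<^sup>2 + 2 * R\<^sup>2 * (norm z)\<^sup>2\<close>.\<close>
      also have "\<dots> \<le> B * (1 + (norm z)\<^sup>2)"
      proof -
        have "0 \<le> (norm z - R)\<^sup>2" "0 \<le> 2 * R\<^sup>2 * (norm z)\<^sup>2" by simp_all
        then show ?thesis unfolding B_def by (simp add: power2_eq_square algebra_simps)
      qed
      finally have "(B * (1 + (norm z)\<^sup>2)) powr (- t) \<le> (1 + (norm x)\<^sup>2) powr (- t)"
        using t by (intro powr_mono2') (auto intro: add_pos_nonneg)
      then have "?l \<le> c * (1 + (norm x)\<^sup>2) powr (- t)"
        using c B by (intro mult_left_mono) (auto simp: powr_mult)
      then show ?thesis using w[of x] by linarith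
    qed
    have "ennreal (c * B powr (- t) * V * (1 + (norm z)\<^sup>2) powr (- t)) = ennreal ?l * emeasure lborel (ball (z + e) \<rho>)"
    proof -
      have "measure lborel (ball (z + e) \<rho>) = V"
        using \<rho> unfolding V_def by (simp add: content_ball)
      moreover have "emeasure lborel (ball (z + e) \<rho>) \<noteq> \<top>"
        using emeasure_lborel_ball_finite[of "z + e" \<rho>] by auto
      ultimately have "emeasure lborel (ball (z + e) \<rho>) = ennreal V"
        by (metis emeasure_eq_ennreal_measure)
      then show ?thesis using l V by (simp add: ennreal_mult[symmetric] mult_ac)
    qed
    also have "\<dots> = (\<integral>\<^sup>+x. ennreal ?l * indicator (ball (z + e) \<rho>) x \<partial>lborel)"
      by (subst nn_integral_cmult_indicator) auto
    also have "\<dots> \<le> (\<integral>\<^sup>+x. ennreal (w x) * indicator (ball (z + e) \<rho>) x \<partial>lborel)"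
      using le by (intro nn_integral_mono) (auto simp: indicator_def ennreal_leI)
    also have "\<dots> = emeasure (density lborel (\<lambda>x. ennreal (w x))) (ball (z + e) \<rho>)"
      by (subst emeasure_density) auto
    finally show "ennreal (c * B powr (- t) * V * (1 + (norm z)\<^sup>2) powr (- t)) \<le> emeasure (density lborel (\<lambda>x. ennreal (w x))) (ball (z + e) \<rho>)" .
  qed
qed

text \<open>The integrand is at least \<open>\<alpha>\<close> on a ball near z whose measure is
  known from below. Since m is arbitrary, the mean of the translate need not be computed.\<close>

lemma variance_translate_ge:
  fixes w :: "real^'d \<Rightarrow> real"
  assumes w_meas [measurable]: "w \<in> borel_measurable borel" and c: "0 < c" and t: "0 \<le> t"
    and w: "\<And>x. c * (1 + (norm x)\<^sup>2) powr (- t) \<le> w x"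
    and P: "prob_space (density lborel (\<lambda>x. ennreal (w x)))"
  obtains \<eta> where "0 < \<eta>"
    "\<And>z m. \<eta> * (1 + (norm z)\<^sup>2) powr (- t) \<le> (\<integral>x. (fejer_kernel (x - z) - m)\<^sup>2 \<partial>(density lborel (\<lambda>x. ennreal (w x))))"
proof -
  let ?P = "density lborel (\<lambda>x. ennreal (w x))"
  interpret prob_space ?P by fact
  obtain \<alpha> \<rho> and v :: "real^'d" where \<alpha>: "0 < \<alpha>" and \<rho>: "0 < \<rho>"
    and far: "\<And>m. \<exists>e\<in>{0, v}. \<forall>y\<in>ball e \<rho>. \<alpha> \<le> (fejer_kernel y - m)\<^sup>2"
    using fejer_kernel_far_from_const by blast
  obtain \<eta> where \<eta>: "0 < \<eta>"
    and ball: "\<And>z e. e \<in> {0, v} \<Longrightarrow> ennreal (\<eta> * (1 + (norm z)\<^sup>2) powr (- t)) \<le> emeasure ?P (ball (z + e) \<rho>)"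
    using measure_ball_weighted_ge[OF w_meas c t \<rho> w, of v] by blast
  show thesis
  proof (rule that[of "\<alpha> * \<eta>"])
    show "0 < \<alpha> * \<eta>" using \<alpha> \<eta> by simp
    fix z :: "real^'d" and m :: real
    obtain e where e: "e \<in> {0, v}" and ge: "\<forall>y\<in>ball e \<rho>. \<alpha> \<le> (fejer_kernel y - m)\<^sup>2"
      using far by blast
    have meas [measurable]: "(\<lambda>x. fejer_kernel (x - z)) \<in> borel_measurable borel"
      by (intro borel_measurable_continuous_onI continuous_on_compose2[OF continuous_on_fejer_kernel[of UNIV]])
         (auto intro!: continuous_intros)
    have "\<eta> * (1 + (norm z)\<^sup>2) powr (- t) \<le> prob (ball (z + e) \<rho>)"
      using ball[OF e, of z] by (simp add: emeasure_eq_measure)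
    then have "\<alpha> * \<eta> * (1 + (norm z)\<^sup>2) powr (- t) \<le> \<alpha> * prob (ball (z + e) \<rho>)"
      using \<alpha> by (simp add: mult.assoc)
    also have "\<dots> = (\<integral>x. \<alpha> * indicator (ball (z + e) \<rho>) x \<partial>?P)"
      by simp
    also have "\<dots> \<le> (\<integral>x. (fejer_kernel (x - z) - m)\<^sup>2 \<partial>?P)"
    proof (rule integral_mono)
      show "integrable ?P (\<lambda>x. \<alpha> * indicat_real (ball (z + e) \<rho>) x)"
        by (intro integrable_mult_right integrable_real_indicator) (auto simp: emeasure_eq_measure)
      have "\<bar>fejer_kernel (x - z) - m\<bar> \<le> 4 ^ CARD('d) + \<bar>m\<bar>" for x
        using fejer_kernel_le[of "x - z"] fejer_kernel_nonneg[of "x - z"] by linarith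
      then have "norm ((fejer_kernel (x - z) - m)\<^sup>2) \<le> (4 ^ CARD('d) + \<bar>m\<bar>)\<^sup>2" for x
        by (simp add: abs_le_square_iff[symmetric])
      then show "integrable ?P (\<lambda>x. (fejer_kernel (x - z) - m)\<^sup>2)"
        by (intro integrable_const_bound[where B="(4 ^ CARD('d) + \<bar>m\<bar>)\<^sup>2"]) auto
      fix x
      show "\<alpha> * indicator (ball (z + e) \<rho>) x \<le> (fejer_kernel (x - z) - m)\<^sup>2"
        using ge by (auto simp: indicator_def dist_norm algebra_simps)
    qed
    finally show "\<alpha> * \<eta> * (1 + (norm z)\<^sup>2) powr (- t) \<le> (\<integral>x. (fejer_kernel (x - z) - m)\<^sup>2 \<partial>?P)" .
  qed
qed

section \<open>Dyadic boxes of lattice points\<close>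

definition dyadic_box :: "nat \<Rightarrow> ('d::finite \<Rightarrow> nat) set" where
  "dyadic_box k = PiE UNIV (\<lambda>_. {2 ^ k..<2 ^ Suc k})"

lemma finite_dyadic_box: "finite (dyadic_box k)"
  unfolding dyadic_box_def by (intro finite_PiE) auto

lemma card_dyadic_box: "card (dyadic_box k :: ('d::finite \<Rightarrow> nat) set) = 2 ^ (k * CARD('d))"
  by (simp add: dyadic_box_def card_PiE power_mult)

text \<open>Any single coordinate of a point determines its level, so boxes of different levels are
  disjoint and pairs of level and point index distinct lattice points.\<close>

lemma inj_on_snd_dyadic_boxes: "inj_on snd (Sigma A (dyadic_box :: nat \<Rightarrow> ('d::finite \<Rightarrow> nat) set))"
proof -
  have "k = l" if "n \<in> dyadic_box k" "n \<in> dyadic_box l" for k l and n :: "'d \<Rightarrow> nat"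
  proof (rule ccontr)
    assume "k \<noteq> l"
    fix j :: 'd
    have b: "2 ^ k \<le> n j" "n j < 2 ^ Suc k" "2 ^ l \<le> n j" "n j < 2 ^ Suc l"
      using that by (auto simp: dyadic_box_def PiE_iff)
    then have "(2::nat) ^ k < 2 ^ Suc l" "(2::nat) ^ l < 2 ^ Suc k" by linarith+
    then have "k < Suc l" "l < Suc k" by (auto intro: power_less_imp_less_exp[of "2::nat"] simp del: power_Suc)
    then show False using \<open>k \<noteq> l\<close> by simp
  qed
  then show ?thesis by (auto simp: inj_on_def)
qed

lemma norm_lattice_pt_dyadic_box:
  fixes n :: "'d::finite \<Rightarrow> nat"
  assumes "n \<in> dyadic_box k"
  shows "1 + (norm (lattice_pt n))\<^sup>2 \<le> (1 + 4 * real CARD('d)) * 4 ^ k"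
proof -
  have "(real (n j))\<^sup>2 \<le> 4 * 4 ^ k" for j
  proof -
    have "n j < 2 ^ Suc k" using assms by (auto simp: dyadic_box_def PiE_iff)
    then have "real (n j) \<le> 2 * 2 ^ k"
      by (metis less_imp_le of_nat_le_iff of_nat_numeral of_nat_power power_Suc)
    then have "(real (n j))\<^sup>2 \<le> (2 * 2 ^ k)\<^sup>2" by (intro power_mono) auto
    then show ?thesis by (simp add: power_mult_distrib power2_eq_square[of "2 ^ k"] flip: power_mult_distrib)
  qed
  then have "(\<Sum>j\<in>UNIV. (real (n j))\<^sup>2) \<le> (\<Sum>j\<in>(UNIV :: 'd set). 4 * 4 ^ k)"
    by (intro sum_mono)
  then have "(norm (lattice_pt n))\<^sup>2 \<le> real CARD('d) * (4 * 4 ^ k)"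
    by (simp only: power2_norm_eq_inner inner_vec_def) (simp add: lattice_pt_def power2_eq_square)
  moreover have "(1::real) \<le> 4 ^ k" by simp
  ultimately show ?thesis unfolding distrib_right by linarith
qed

section \<open>Choice of the coefficients and conclusion\<close>

theorem theorem4:
  fixes \<phi>0 :: "real^'d \<Rightarrow> real"
    and s \<delta> c :: real and p q :: ereal
    and \<phi> :: "real^'d \<Rightarrow> real"
  assumes "smooth_fun \<phi>0"
    and "\<And>x. norm x \<le> 1 \<Longrightarrow> \<phi>0 x = 1"
    and "\<And>x. norm x \<ge> 3/2 \<Longrightarrow> \<phi>0 x = 0"
    and "2 < p" and "1 \<le> q"
    and "s > real CARD('d) / 2"
    and "0 < \<delta>"
    and "\<delta> \<le> real CARD('d) / 2 - (if p = \<infinity> then 0 else real CARD('d) / real_of_ereal p)"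
    and "\<phi> \<in> borel_measurable borel"
    and "c > 0" and "\<And>x. \<phi> x \<ge> c"
    and "(\<integral>\<^sup>+ x. ennreal (\<phi> x * jbracket x (- real CARD('d) - 2 * \<delta>)) \<partial>lborel) = 1"
  shows "\<not> pregaussian TYPE('w)
           (density lborel (\<lambda>x. ennreal (\<phi> x * jbracket x (- real CARD('d) - 2 * \<delta>))))
           (besov_unit_ball \<phi>0 s p q)"
proof -
  interpret lp_cutoff \<phi>0 using assms(1-3) by unfold_locales
  let ?d = "real CARD('d)"
  \<comment> \<open>The density's decay is then the power -t of
    \<open>1 + (norm x)\<^sup>2\<close>.\<close>
  define t where "t = ?d / 2 + \<delta>"
  have t: "0 \<le> t" using \<open>0 < \<delta>\<close> by (simp add: t_def)
  define w where "w x = \<phi> x * jbracket x (- ?d - 2 * \<delta>)" for x :: "real^'d"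
  define P where "P = density lborel (\<lambda>x. ennreal (w x))"
  note [measurable] = \<open>\<phi> \<in> borel_measurable borel\<close>
  have exponent: "(- ?d - 2 * \<delta>) / 2 = - t" by (simp add: t_def field_simps)
  have w_meas [measurable]: "w \<in> borel_measurable borel"
    unfolding w_def jbracket_def by measurable
  have w_ge: "c * (1 + (norm x)\<^sup>2) powr (- t) \<le> w x" for x
    unfolding w_def jbracket_def exponent by (intro mult_right_mono assms) simp
  have P: "prob_space P"
  proof (rule prob_spaceI)
    show "emeasure P (space P) = 1"
      using assms(12) unfolding P_def by (subst emeasure_density) (auto simp: w_def[symmetric])
  qed
  obtain \<eta> where \<eta>: "0 < \<eta>"
    and var: "\<And>z m. \<eta> * (1 + (norm z)\<^sup>2) powr (- t) \<le> (\<integral>x. (fejer_kernel (x - z) - m)\<^sup>2 \<partial>P)"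
    using variance_translate_ge[OF w_meas \<open>c > 0\<close> t w_ge P[unfolded P_def]] unfolding P_def by blast
  \<comment> \<open>The reciprocal of p, with value 0 for infinite p, so that both cases share one
    computation.\<close>
  define r where "r = (if p = \<infinity> then 0 else 1 / real_of_ereal p)"
  have r: "0 \<le> r" "r \<le> 1/2"
    using \<open>2 < p\<close> by (cases p; auto simp: r_def field_simps)+
  \<comment> \<open>The upper bound on \<open>\<delta>\<close> enters here: the expression equals
    d/2 - d/p - \<open>\<delta>\<close>.\<close>
  have r_exp: "0 \<le> ?d - ?d * r - t"
    using assms(8) by (cases "p = \<infinity>") (auto simp: r_def t_def)
  have p1: "1 \<le> p" using \<open>2 < p\<close> by (cases p) (auto simp: one_ereal_def)
  define L where "L = (fejer_mass / pi) ^ CARD('d) * kernel_bound TYPE('d)"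
  have L: "0 \<le> L"
    unfolding L_def using kernel_bound_ge(1)[where 'd='d]
    by (auto simp: fejer_mass_nonneg)
  define \<kappa> where "\<kappa> = 1 / (L + 1)"
  have \<kappa>: "0 < \<kappa>" "L * \<kappa> \<le> 1" using L by (auto simp: \<kappa>_def)
  define h where "h i x = \<kappa> * fejer_kernel (x - lattice_pt (snd i))" for i :: "nat \<times> ('d \<Rightarrow> nat)" and x
  have in_ball: "(\<lambda>x. \<Sum>i\<in>I. b i * h i x) \<in> besov_unit_ball \<phi>0 s p q"
    if "finite I" "inj_on snd I" "\<And>i. i \<in> I \<Longrightarrow> 0 < a i" "unit_lp p I a" "\<And>i. i \<in> I \<Longrightarrow> \<bar>b i\<bar> \<le> a i" for I a b
    unfolding h_def using that \<kappa>
    by (intro sum_translates_in_besov_unit_ball p1 \<open>1 \<le> q\<close>) (auto simp: L_def mult_ac)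
  have h_ball: "h i \<in> besov_unit_ball \<phi>0 s p q" for i
    using in_ball[of "{i}" "\<lambda>_. 1" "\<lambda>_. 1"] by (simp add: unit_lp_def)
  define \<gamma> where "\<gamma> = \<kappa> * sqrt \<eta> * (1 + 4 * ?d) powr (- t / 2)"
  have \<gamma>: "0 < \<gamma>" using \<kappa> \<eta> by (simp add: \<gamma>_def add_pos_nonneg)
  have sd: "\<gamma> * 2 powr (- (real k * t)) \<le> sqrt (\<integral>x. (h (k, n) x - (\<integral>y. h (k, n) y \<partial>P))\<^sup>2 \<partial>P)"
    if n: "n \<in> dyadic_box k" for k n
  proof -
    let ?z = "lattice_pt n"
    define m where "m = (\<integral>y. h (k, n) y \<partial>P)"
    have "\<gamma>\<^sup>2 * (2 powr (- (real k * t)))\<^sup>2 = \<kappa>\<^sup>2 * (\<eta> * ((1 + 4 * ?d) * 4 ^ k) powr (- t))"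
    proof -
      have "(2 powr (- (real k * t)))\<^sup>2 = 2 powr (real (2 * k) * - t)"
        by (simp add: power2_eq_square powr_add[symmetric] algebra_simps)
      also have "\<dots> = (2 powr real (2 * k)) powr (- t)"
        by (rule powr_powr[symmetric])
      also have "(2::real) powr real (2 * k) = 4 ^ k"
        by (simp add: powr_realpow power_mult del: of_nat_mult)
      finally have "(2 powr (- (real k * t)))\<^sup>2 = (4 ^ k) powr (- t)" .
      moreover have "((1 + 4 * ?d) powr (- t / 2))\<^sup>2 = (1 + 4 * ?d) powr (- t)"
        by (simp add: power2_eq_square powr_add[symmetric])
      ultimately show ?thesis
        using \<eta> by (simp add: \<gamma>_def power_mult_distrib powr_mult)
    qed
    also have "\<dots> \<le> \<kappa>\<^sup>2 * (\<eta> * (1 + (norm ?z)\<^sup>2) powr (- t))"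
      using norm_lattice_pt_dyadic_box[OF n] t \<eta>
      by (intro mult_left_mono powr_mono2') (auto intro: add_pos_nonneg)
    \<comment> \<open>The constant is \<open>m / \<kappa>\<close> because \<open>h\<close> is
      \<open>\<kappa>\<close> times a translate of the kernel.\<close>
    also have "\<dots> \<le> \<kappa>\<^sup>2 * (\<integral>x. (fejer_kernel (x - ?z) - m / \<kappa>)\<^sup>2 \<partial>P)"
      by (intro mult_left_mono var) simp
    also have "\<dots> = (\<integral>x. (h (k, n) x - m)\<^sup>2 \<partial>P)"
    proof -
      have "(h (k, n) x - m)\<^sup>2 = \<kappa>\<^sup>2 * (fejer_kernel (x - ?z) - m / \<kappa>)\<^sup>2" for x
        using \<kappa>(1) unfolding power_mult_distrib[symmetric] by (simp add: h_def right_diff_distrib)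
      then show ?thesis by simp
    qed
    finally show ?thesis
      by (intro real_le_rsqrt) (simp add: power_mult_distrib m_def)
  qed
  show ?thesis
    unfolding w_def[symmetric] P_def[symmetric]
  proof (rule not_pregaussian_if_large_sums[where 'i = "nat \<times> ('d \<Rightarrow> nat)", OF P])
    fix B :: real
    obtain K :: nat where K: "max 1 ((B / \<gamma>)\<^sup>2) \<le> real K"
      using real_arch_simple by blast
    then have K1: "1 \<le> real K" by simp
    have "B / \<gamma> \<le> sqrt (real K)" using K by (intro real_le_rsqrt) simp
    then have KB: "B \<le> \<gamma> * sqrt (real K)" using \<gamma> by (simp add: divide_le_eq mult.commute)
    let ?I = "Sigma {..<K} dyadic_box :: (nat \<times> ('d \<Rightarrow> nat)) set"
    \<comment> \<open>Box k has \<open>2 ^ (k * d)\<close> points, and for finite p each contributes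
      2 to the power -kd, divided by K, to the sum of p-th powers. The K boxes together give exactly
      1. For infinite p all coefficients are 1.\<close>
    define a where "a i = real K powr (- r) * 2 powr (- (real (fst i) * ?d * r))" for i :: "nat \<times> ('d \<Rightarrow> nat)"
    have I: "finite ?I" by (auto simp: finite_dyadic_box)
    have a_pos: "0 < a i" for i using K1 by (simp add: a_def)
    have sum_I: "(\<Sum>i\<in>?I. g (fst i)) = (\<Sum>k<K. 2 ^ (k * CARD('d)) * g k)" for g :: "nat \<Rightarrow> real"
      by (subst sum.Sigma[symmetric, of "{..<K}" dyadic_box "\<lambda>k n. g k", unfolded case_prod_beta])
         (auto simp: finite_dyadic_box card_dyadic_box)
    have pow: "(2::real) ^ (k * CARD('d)) = 2 powr (real k * ?d)" for k
      by (simp flip: powr_realpow of_nat_mult)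
    have unit: "unit_lp p ?I a"
    proof (cases "p = \<infinity>")
      case True
      then show ?thesis using K1 by (simp add: unit_lp_def a_def r_def)
    next
      case False
      let ?p = "real_of_ereal p"
      have pr: "r * ?p = 1" using False \<open>2 < p\<close> by (cases p) (auto simp: r_def)
      have "(\<Sum>i\<in>?I. a i powr ?p) = (\<Sum>k<K. 2 ^ (k * CARD('d)) * ((real K powr (- r) * 2 powr (- (real k * ?d * r))) powr ?p))"
        unfolding a_def by (rule sum_I)
      also have "\<dots> = (\<Sum>k<K. 1 / real K)"
      proof (intro sum.cong refl)
        fix k
        have "(real K powr (- r) * 2 powr (- (real k * ?d * r))) powr ?p = real K powr (- (r * ?p)) * 2 powr (- (real k * ?d * (r * ?p)))"
          by (simp add: powr_mult powr_powr mult.assoc)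
        then show "2 ^ (k * CARD('d)) * ((real K powr (- r) * 2 powr (- (real k * ?d * r))) powr ?p) = 1 / real K"
          using K1 unfolding pr pow by (simp add: powr_minus field_simps)
      qed
      also have "\<dots> = 1" using K1 by simp
      finally show ?thesis using False by (simp add: unit_lp_def)
    qed
    have "B \<le> \<gamma> * real K powr (1/2)"
      using KB K1 by (simp add: powr_half_sqrt)
    \<comment> \<open>As p exceeds 2, 1 - r is at least 1/2, the exponent for which K was
      chosen.\<close>
    also have "\<dots> \<le> \<gamma> * real K powr (1 - r)"
      using \<gamma> r K1 by (intro mult_left_mono powr_mono) auto
    also have "\<dots> = (\<Sum>k<K. real K powr (- r) * \<gamma>)"
      using K1 by (simp add: powr_diff powr_minus field_simps)
    also have "\<dots> \<le> (\<Sum>k<K. 2 ^ (k * CARD('d)) * (real K powr (- r) * 2 powr (- (real k * ?d * r)) * (\<gamma> * 2 powr (- (real k * t)))))"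
    proof (intro sum_mono)
      fix k
      \<comment> \<open>The number of points in box k outweighs the decay of coefficients and
        standard deviations, so every level contributes at least
        \<open>real K powr (- r) * \<gamma>\<close>.\<close>
      have "1 \<le> 2 powr (real k * (?d - ?d * r - t))"
        using r_exp by (intro ge_one_powr_ge_zero) auto
      also have "\<dots> = 2 ^ (k * CARD('d)) * 2 powr (- (real k * ?d * r)) * 2 powr (- (real k * t))"
        unfolding pow powr_add[symmetric] by (simp add: algebra_simps)
      finally have "real K powr (- r) * \<gamma> * 1 \<le> real K powr (- r) * \<gamma> * (2 ^ (k * CARD('d)) * 2 powr (- (real k * ?d * r)) * 2 powr (- (real k * t)))"
        using \<gamma> by (intro mult_left_mono) auto
      then show "real K powr (- r) * \<gamma> \<le> 2 ^ (k * CARD('d)) * (real K powr (- r) * 2 powr (- (real k * ?d * r)) * (\<gamma> * 2 powr (- (real k * t))))"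
        by (simp add: mult_ac)
    qed
    also have "\<dots> = (\<Sum>i\<in>?I. a i * (\<gamma> * 2 powr (- (real (fst i) * t))))"
      unfolding a_def by (rule sum_I[symmetric])
    also have "\<dots> \<le> (\<Sum>i\<in>?I. a i * sqrt (\<integral>x. (h i x - (\<integral>y. h i y \<partial>P))\<^sup>2 \<partial>P))"
      using sd by (intro sum_mono mult_left_mono) (auto simp: a_pos less_imp_le)
    finally have W: "B \<le> (\<Sum>i\<in>?I. a i * sqrt (\<integral>x. (h i x - (\<integral>y. h i y \<partial>P))\<^sup>2 \<partial>P))" .
    show "\<exists>(I :: (nat \<times> ('d \<Rightarrow> nat)) set) h a. finite I \<and> (\<forall>i\<in>I. 0 \<le> a i \<and> h i \<in> besov_unit_ball \<phi>0 s p q) \<and>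
      (\<forall>b. (\<forall>i\<in>I. \<bar>b i\<bar> \<le> a i) \<longrightarrow> (\<lambda>x. \<Sum>i\<in>I. b i * h i x) \<in> besov_unit_ball \<phi>0 s p q) \<and>
      B \<le> (\<Sum>i\<in>I. a i * sqrt (\<integral>x. (h i x - (\<integral>y. h i y \<partial>P))\<^sup>2 \<partial>P))"
      by (intro exI[of _ ?I] exI[of _ h] exI[of _ a] conjI ballI allI impI)
        (auto simp: W I h_ball a_pos less_imp_le intro!: in_ball[OF I inj_on_snd_dyadic_boxes a_pos unit])
  qed
qed

end
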